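(* Let $n,m\in\mathbb{N}$ with $m\ge 2$. Let $F\in C(\mathbb{R}^n,\mathbb{C}^{m\times m})$ be conditionally positive semidefinite and suppose there exists $c\in\mathbb{R}$ such that $\operatorname{Re}(F(x)_{j,k})\le c$ for all $x\in\mathbb{R}^n$, $1\le j,k\le m$. Then for all $t>0$, the bounded operator $(\exp_H(tF))(-i\nabla)$ on $L^2(\mathbb{R}^n,\mathbb{C}^{m\times m})$ is not positivity preserving.
   Context: A self-adjoint matrix $A=A^*\in\mathbb{C}^{M\times M}$ is conditionally positive semidefinite if $\sum_{j,k}\overline{c_j}A_{j,k}c_k\ge 0$ for all $c\in\mathbb{C}^M$ with $\sum_{j=1}^M c_j=0$. A function $F\colon\mathbb{R}^n\to\mathbb{C}^{m\times m}$ is conditionally positive semidefinite if for all $N\in\mathbb{N}$ and $x_1,\dots,x_N\in\mathbb{R}^n$ the block matrix $\{F(x_p-x_q)\}_{1\le p,q\le N}\in\mathbb{C}^{mN\times mN}$ is conditionally positive semidefinite. The Hadamard exponential is entrywise: $\exp_H(G(x))_{j,k}=\exp(G(x)_{j,k})$. $L^2(\mathbb{R}^n,\mathbb{C}^{m\times m})$ is the space of measurable $f\colon\mathbb{R}^n\to\mathbb{C}^{m\times m}$ with $\int_{\mathbb{R}^n}\|f(x)\|_{\mathcal{B}(\mathbb{C}^m)}^2\,d^nx<\infty$. Fourier transforms (entrywise): $f^\wedge(y)=(2\pi)^{-n/2}\int_{\mathbb{R}^n}e^{-iy\cdot x}f(x)\,d^nx$, with inverse $g^\vee(x)=(2\pi)^{-n/2}\int_{\mathbb{R}^n}e^{ix\cdot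 y}g(y)\,d^ny$, extended to $L^2$. For $G\in L^\infty(\mathbb{R}^n,\mathbb{C}^{m\times m})$, $G(-i\nabla)f=(f^\wedge G)^\vee$ for $f\in L^2(\mathbb{R}^n,\mathbb{C}^{m\times m})$, where $f^\wedge G$ is the pointwise matrix product with $G$ on the right. A bounded operator $T$ on $L^2(\mathbb{R}^n,\mathbb{C}^{m\times m})$ is positivity preserving if for every $f\in L^2(\mathbb{R}^n,\mathbb{C}^{m\times m})$ such that $f(x)$ is a positive semidefinite matrix for a.e. $x$, also $(Tf)(x)$ is positive semidefinite for a.e. $x$. *)

theory Defs
  imports "HOL-Analysis.Analysis"
begin

text \<open>
  Matrices whose size varies are functions of two indices, restricted to an index set \<open>I\<close>.
\<close>
definition cond_pos_semidef_on :: "'i set \<Rightarrow> ('i \<Rightarrow> 'i \<Rightarrow> complex) \<Rightarrow> bool" where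
  "cond_pos_semidef_on I A \<longleftrightarrow>
     (\<forall>j\<in>I. \<forall>k\<in>I. A j k = cnj (A k j)) \<and>
     (\<forall>c :: 'i \<Rightarrow> complex. (\<Sum>j\<in>I. c j) = 0 \<longrightarrow>
        (\<Sum>j\<in>I. \<Sum>k\<in>I. cnj (c j) * A j k * c k) \<in> \<real>\<^sub>\<ge>\<^sub>0)"

text \<open>
  The \<open>mN \<times> mN\<close> block matrix with blocks \<open>F (x\<^sub>p - x\<^sub>q)\<close> is indexed by the pairs \<open>(p, j)\<close>,
  where \<open>p\<close> is the block number and \<open>j\<close> the position within the block.
\<close>
definition cond_pos_semidef_fun :: "(real ^ 'n \<Rightarrow> complex ^ 'm ^ 'm) \<Rightarrow> bool" where
  "cond_pos_semidef_fun F \<longleftrightarrow>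
     (\<forall>(N :: nat) (x :: nat \<Rightarrow> real ^ 'n).
        cond_pos_semidef_on ({..<N} \<times> (UNIV :: 'm set))
          (\<lambda>(p, j) (q, k). F (x p - x q) $ j $ k))"

definition pos_semidef :: "complex ^ 'm ^ 'm \<Rightarrow> bool" where
  "pos_semidef A \<longleftrightarrow>
     (\<forall>j k. A $ j $ k = cnj (A $ k $ j)) \<and>
     (\<forall>c :: complex ^ 'm. (\<Sum>j\<in>UNIV. \<Sum>k\<in>UNIV. cnj (c $ j) * A $ j $ k * c $ k) \<in> \<real>\<^sub>\<ge>\<^sub>0)"

definition exp_Hadamard :: "('a \<Rightarrow> complex ^ 'm ^ 'm) \<Rightarrow> 'a \<Rightarrow> complex ^ 'm ^ 'm" where
  "exp_Hadamard G x = (\<chi> j k. exp (G x $ j $ k))"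

text \<open>
  Elements of \<open>L\<^sup>2\<close> are represented by Borel functions; identification of functions that agree
  almost everywhere is made explicit where it matters.
\<close>
definition L2_scalar :: "(real ^ 'n \<Rightarrow> complex) \<Rightarrow> bool" where
  "L2_scalar f \<longleftrightarrow>
     f \<in> borel_measurable lborel \<and> integrable lborel (\<lambda>x. (cmod (f x))\<^sup>2)"

text \<open>
  The norm of \<open>complex ^ 'm\<close> is Euclidean, so \<open>onorm\<close> gives the norm of \<open>\<B>(\<complex>\<^sup>m)\<close>; the
  \<open>norm\<close> of \<open>complex ^ 'm ^ 'm\<close> would be the Frobenius norm.
\<close>
definition L2_matrix :: "(real ^ 'n \<Rightarrow> complex ^ 'm ^ 'm) \<Rightarrow> bool" where
  "L2_matrix f \<longleftrightarrow>
     f \<in> borel_measurable lborel \<and> integrable lborel (\<lambda>x. (onorm ((*v) (f x)))\<^sup>2)"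

definition L2_matrix_norm :: "(real ^ 'n \<Rightarrow> complex ^ 'm ^ 'm) \<Rightarrow> real" where
  "L2_matrix_norm f = sqrt (\<integral>x. (onorm ((*v) (f x)))\<^sup>2 \<partial>lborel)"

definition fourier_int :: "(real ^ 'n \<Rightarrow> complex) \<Rightarrow> real ^ 'n \<Rightarrow> complex" where
  "fourier_int f y =
     complex_of_real ((2 * pi) powr (- real CARD('n) / 2)) *
     (\<integral>x. exp (- \<i> * complex_of_real (y \<bullet> x)) * f x \<partial>lborel)"

definition inv_fourier_int :: "(real ^ 'n \<Rightarrow> complex) \<Rightarrow> real ^ 'n \<Rightarrow> complex" where
  "inv_fourier_int g x =
     complex_of_real ((2 * pi) powr (- real CARD('n) / 2)) *
     (\<integral>y. exp (\<i> * complex_of_real (x \<bullet> y)) * g y \<partial>lborel)"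

text \<open>
  Extension by continuity of an operator \<open>S\<close> from \<open>L\<^sup>1 \<inter> L\<^sup>2\<close> to \<open>L\<^sup>2\<close>: \<open>L2_limit S f g\<close> says
  that \<open>g\<close> is the \<open>L\<^sup>2\<close> limit of \<open>S u\<^sub>k\<close> for some \<open>u\<^sub>k \<in> L\<^sup>1 \<inter> L\<^sup>2\<close> tending to \<open>f\<close> in \<open>L\<^sup>2\<close>. For the
  Fourier integrals such a \<open>g\<close> exists and is unique up to null sets by Plancherel's theorem, and
  \<open>L2_extension\<close> selects a representative. The distances are Lebesgue integrals in
  \<open>[0, \<infinity>]\<close>, as the Bochner integral of a nonintegrable function is \<open>0\<close> by convention.
\<close>
definition L2_limit ::
  "((real ^ 'n \<Rightarrow> complex) \<Rightarrow> real ^ 'n \<Rightarrow> complex) \<Rightarrow>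
   (real ^ 'n \<Rightarrow> complex) \<Rightarrow> (real ^ 'n \<Rightarrow> complex) \<Rightarrow> bool" where
  "L2_limit S f g \<longleftrightarrow>
     L2_scalar g \<and>
     (\<exists>u :: nat \<Rightarrow> real ^ 'n \<Rightarrow> complex.
        (\<forall>k. integrable lborel (u k) \<and> L2_scalar (u k)) \<and>
        (\<lambda>k. \<integral>\<^sup>+x. ennreal ((cmod (u k x - f x))\<^sup>2) \<partial>lborel) \<longlonglongrightarrow> 0 \<and>
        (\<lambda>k. \<integral>\<^sup>+y. ennreal ((cmod (S (u k) y - g y))\<^sup>2) \<partial>lborel) \<longlonglongrightarrow> 0)"

definition L2_extension ::
  "((real ^ 'n \<Rightarrow> complex) \<Rightarrow> real ^ 'n \<Rightarrow> complex) \<Rightarrow>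
   (real ^ 'n \<Rightarrow> complex) \<Rightarrow> real ^ 'n \<Rightarrow> complex" where
  "L2_extension S f = (SOME g. L2_limit S f g)"

definition fourier_matrix ::
  "(real ^ 'n \<Rightarrow> complex ^ 'm ^ 'm) \<Rightarrow> real ^ 'n \<Rightarrow> complex ^ 'm ^ 'm" where
  "fourier_matrix f y = (\<chi> j k. L2_extension fourier_int (\<lambda>x. f x $ j $ k) y)"

definition inv_fourier_matrix ::
  "(real ^ 'n \<Rightarrow> complex ^ 'm ^ 'm) \<Rightarrow> real ^ 'n \<Rightarrow> complex ^ 'm ^ 'm" where
  "inv_fourier_matrix g x = (\<chi> j k. L2_extension inv_fourier_int (\<lambda>y. g y $ j $ k) x)"

text \<open>The operator \<open>G(-i\<nabla>)\<close>.\<close>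
definition fourier_multiplier ::
  "(real ^ 'n \<Rightarrow> complex ^ 'm ^ 'm) \<Rightarrow>
   (real ^ 'n \<Rightarrow> complex ^ 'm ^ 'm) \<Rightarrow> real ^ 'n \<Rightarrow> complex ^ 'm ^ 'm" where
  "fourier_multiplier G f = inv_fourier_matrix (\<lambda>y. fourier_matrix f y ** G y)"

text \<open>
  Compatibility with almost everywhere equality follows from linearity and boundedness.
\<close>
definition bounded_L2_operator ::
  "((real ^ 'n \<Rightarrow> complex ^ 'm ^ 'm) \<Rightarrow> real ^ 'n \<Rightarrow> complex ^ 'm ^ 'm) \<Rightarrow> bool" where
  "bounded_L2_operator T \<longleftrightarrow>
     (\<forall>f. L2_matrix f \<longrightarrow> L2_matrix (T f)) \<and>
     (\<forall>f g. L2_matrix f \<longrightarrow> L2_matrix g \<longrightarrow>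
        (AE x in lborel. T (\<lambda>x. f x + g x) x = T f x + T g x)) \<and>
     (\<forall>(a :: complex) f. L2_matrix f \<longrightarrow>
        (AE x in lborel. T (\<lambda>x. \<chi> j k. a * f x $ j $ k) x = (\<chi> j k. a * T f x $ j $ k))) \<and>
     (\<exists>C. \<forall>f. L2_matrix f \<longrightarrow> L2_matrix_norm (T f) \<le> C * L2_matrix_norm f)"

definition positivity_preserving ::
  "((real ^ 'n \<Rightarrow> complex ^ 'm ^ 'm) \<Rightarrow> real ^ 'n \<Rightarrow> complex ^ 'm ^ 'm) \<Rightarrow> bool" where
  "positivity_preserving T \<longleftrightarrow>
     (\<forall>f. L2_matrix f \<longrightarrow> (AE x in lborel. pos_semidef (f x)) \<longrightarrow>
        (AE x in lborel. pos_semidef (T f x)))"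

end

theory Submission
  imports Defs "HOL-Probability.Characteristic_Functions"
begin

text \<open>
  Right multiplication by the symbol \<open>G = exp\<^sub>H(tF)\<close> acts on each row of the Fourier transform
  separately. If \<open>f\<close> is a Gaussian times the matrix unit at \<open>(i, i)\<close>, then the image of \<open>f\<close> is
  supported in row \<open>i\<close>, with entry \<open>(i, k)\<close> equal to the inverse transform of a Gaussian times
  \<open>G\<^sub>i\<^sub>k\<close>. If the image were positive semidefinite, hence self-adjoint, this entry would vanish for
  \<open>k \<noteq> i\<close>; but an exponential has no zero.

  Boundedness and the well-definedness of the \<open>L\<^sup>2\<close> extensions only need the inequality
  \<open>\<parallel>u\<^sup>\<and>\<parallel> \<le> \<parallel>u\<parallel>\<close> on \<open>L\<^sup>1 \<inter> L\<^sup>2\<close>, not the full Plancherel theorem, together with completeness of \<open>L\<^sup>2\<close>.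
  Injectivity of the inverse transform is only needed at the origin, for continuous functions, and
  follows by pairing with Gaussians.
\<close>

section \<open>Gaussians and the Fourier integral\<close>

text \<open>The obstacle is that \<open>L2_extension\<close> selects an arbitrary limit: a transform
  is known only up to null sets, and only once existence and uniqueness of such limits are
  established. The test function is therefore chosen so that every transform it meets is an honest
  integral. The Gaussian of width 1 is its own Fourier transform under the factor
  \<open>(2 pi)^(-n/2)\<close>; its product with a bounded symbol is both integrable and square
  integrable; and being positive, it can be cancelled at the end.

  A norm inequality on a dense subspace suffices for the extension because it sends Cauchy sequences
  to Cauchy sequences and bounds every possible limit by its input, so that two limits for the same
  input differ by a limit for zero. The value of the symbol at the origin is recovered because the
  centred Gaussians of width r, as r tends to 0, form an approximate identity there, and each of
  them is up to a factor the transform of a Gaussian of width 1/r.\<close>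

lemma
  fixes f :: "'a::euclidean_space \<Rightarrow> real \<Rightarrow> complex"
  assumes f: "\<And>b. b \<in> Basis \<Longrightarrow> integrable lborel (f b)"
  shows integrable_lborel_prod: "integrable lborel (\<lambda>x::'a. \<Prod>b\<in>Basis. f b (x \<bullet> b))" (is ?I)
    and integral_lborel_prod:
      "(\<integral>x. (\<Prod>b\<in>Basis. f b ((x::'a) \<bullet> b)) \<partial>lborel) = (\<Prod>b\<in>Basis. \<integral>x. f b x \<partial>lborel)" (is ?E)
proof -
  interpret product_sigma_finite "\<lambda>_::'a. lborel :: real measure" ..
  have [measurable]: "f b \<in> borel_measurable borel" if "b \<in> Basis" for b
    using borel_measurable_integrable[OF f[OF that]] by simp
  have *: "(\<Prod>b\<in>Basis. f b ((\<Sum>c\<in>Basis. g c *\<^sub>R c) \<bullet> b)) = (\<Prod>b\<in>Basis. f b (g b))" for g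
    by (intro prod.cong refl) simp
  have "integrable (\<Pi>\<^sub>M b\<in>Basis. lborel) (\<lambda>g. \<Prod>b\<in>Basis. f b (g b))"
    by (intro product_integrable_prod f) auto
  then show ?I
    by (subst lborel_eq, subst integrable_distr_eq) (simp_all add: *)
  show ?E
    by (subst lborel_eq, subst integral_distr) (simp_all add: * product_integral_prod f)
qed

text \<open>The isotropic normal density of standard deviation \<open>s\<close>. The product form
  lets one-dimensional facts about \<open>normal_density\<close> carry over coordinate by
  coordinate; \<open>gauss_eq\<close> gives the radial form.\<close>

definition gauss :: "real \<Rightarrow> 'a::euclidean_space \<Rightarrow> real" where
  "gauss s x = (\<Prod>b\<in>Basis. normal_density 0 s (x \<bullet> b))"

lemma gauss_measurable [measurable]: "gauss s \<in> borel_measurable borel"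
  unfolding gauss_def[abs_def] by measurable

lemma gauss_nonneg [simp]: "0 \<le> gauss s x"
  unfolding gauss_def by (intro prod_nonneg) auto

lemma gauss_pos: "0 < s \<Longrightarrow> 0 < gauss s x"
  unfolding gauss_def by (intro prod_pos) (auto intro: normal_density_pos)

lemma gauss_minus [simp]: "gauss s (- x) = gauss s x"
  by (simp add: gauss_def normal_density_def)

lemma gauss_eq:
  fixes x :: "'a::euclidean_space"
  assumes "0 < s"
  shows "gauss s x = (2 * pi * s\<^sup>2) powr (- real DIM('a) / 2) * exp (- (norm x)\<^sup>2 / (2 * s\<^sup>2))"
proof -
  have p: "0 < 2 * pi * s\<^sup>2"
    using assms by simp
  have 1: "1 / sqrt (2 * pi * s\<^sup>2) = (2 * pi * s\<^sup>2) powr (- 1 / 2)"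
    using p by (simp only: powr_minus_divide powr_half_sqrt minus_divide_left[symmetric])
  have 2: "((2 * pi * s\<^sup>2) powr (- 1 / 2)) ^ DIM('a) = (2 * pi * s\<^sup>2) powr (- real DIM('a) / 2)"
    using p by (subst powr_power) auto
  have "gauss s x = (\<Prod>b\<in>Basis. (2 * pi * s\<^sup>2) powr (- 1 / 2) * exp (- (x \<bullet> b)\<^sup>2 / (2 * s\<^sup>2)))"
    unfolding gauss_def normal_density_def 1 by simp
  also have "\<dots> = (2 * pi * s\<^sup>2) powr (- real DIM('a) / 2) *
      (\<Prod>b\<in>Basis. exp (- (x \<bullet> b)\<^sup>2 / (2 * s\<^sup>2)))"
    by (simp only: prod.distrib prod_constant 2)
  also have "(\<Prod>b\<in>Basis. exp (- (x \<bullet> b)\<^sup>2 / (2 * s\<^sup>2))) =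
      exp (- (\<Sum>b\<in>Basis. (x \<bullet> b)\<^sup>2) / (2 * s\<^sup>2))"
    by (simp add: exp_sum[symmetric] sum_negf sum_divide_distrib)
  also have "(\<Sum>b\<in>Basis. (x \<bullet> b)\<^sup>2) = (norm x)\<^sup>2"
    unfolding power2_norm_eq_inner by (subst euclidean_inner) (simp add: power2_eq_square)
  finally show ?thesis .
qed

lemma integrable_gauss [simp]:
  fixes s :: real assumes "0 < s" shows "integrable lborel (gauss s :: 'a::euclidean_space \<Rightarrow> real)"
proof -
  have "integrable lborel (\<lambda>x::'a. \<Prod>b\<in>Basis. complex_of_real (normal_density 0 s (x \<bullet> b)))"
    using assms by (intro integrable_lborel_prod) (auto intro: integrable_normal_density)
  then have "integrable lborel (\<lambda>x::'a. complex_of_real (gauss s x))"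
    by (simp add: gauss_def)
  then show ?thesis
    by (simp only: complex_of_real_integrable_eq)
qed

text \<open>Rescaling by \<open>s\<close> reduces this to the characteristic function of the
  standard normal distribution, evaluated at \<open>s * t\<close>.\<close>

lemma integral_iexp_normal_density:
  assumes "0 < s"
  shows "(\<integral>x. exp (\<i> * complex_of_real (t * x)) * complex_of_real (normal_density 0 s x) \<partial>lborel) =
    exp (- (s * t)\<^sup>2 / 2)"
proof -
  have "complex_of_real (exp (- (s * t)\<^sup>2 / 2)) = char std_normal_distribution (s * t)"
    by (simp add: char_std_normal_distribution)
  also have "\<dots> = (\<integral>x. std_normal_density x *\<^sub>R exp (\<i> * complex_of_real (s * t * x)) \<partial>lborel)"
    unfolding char_def by (subst integral_density) auto
  also have "\<dots> = \<bar>1 / s\<bar> *\<^sub>R (\<integral>x. std_normal_density (0 + 1 / s * x) *\<^sub>R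
      exp (\<i> * complex_of_real (s * t * (0 + 1 / s * x))) \<partial>lborel)"
    using assms by (intro lborel_integral_real_affine) simp
  also have "\<dots> = (\<integral>x. (1 / s) *\<^sub>R (std_normal_density (0 + 1 / s * x) *\<^sub>R
      exp (\<i> * complex_of_real (s * t * (0 + 1 / s * x)))) \<partial>lborel)"
    unfolding integral_scaleR_right using assms by simp
  also have "\<dots> = (\<integral>x. exp (\<i> * complex_of_real (t * x)) *
      complex_of_real (normal_density 0 s x) \<partial>lborel)"
  proof (intro Bochner_Integration.integral_cong refl)
    fix x :: real
    have a: "1 / s * std_normal_density (0 + 1 / s * x) = normal_density 0 s x"
      using assms by (simp add: normal_density_def real_sqrt_mult power_divide ac_simps)
    have b: "s * t * (0 + 1 / s * x) = t * x"
      using assms by simp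
    show "(1 / s) *\<^sub>R (std_normal_density (0 + 1 / s * x) *\<^sub>R
        exp (\<i> * complex_of_real (s * t * (0 + 1 / s * x)))) =
        exp (\<i> * complex_of_real (t * x)) * complex_of_real (normal_density 0 s x)"
      unfolding scaleR_scaleR a b by (simp add: scaleR_conv_of_real mult.commute)
  qed
  finally show ?thesis ..
qed

text \<open>Both the character and the density factor over the coordinates, so the integral is a
  product of one-dimensional ones, whose exponents add up to the squared norm.\<close>

lemma integral_iexp_gauss:
  fixes t :: "'a::euclidean_space"
  assumes "0 < s"
  shows "(\<integral>x. exp (\<i> * complex_of_real (t \<bullet> x)) * complex_of_real (gauss s x) \<partial>lborel) =
    complex_of_real (exp (- (s * norm t)\<^sup>2 / 2))"
proof -
  have "exp (\<i> * complex_of_real (t \<bullet> x)) = (\<Prod>b\<in>Basis. exp (\<i> * complex_of_real ((t \<bullet> b) * (x \<bullet> b))))"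
    for x
    by (subst euclidean_inner) (simp add: exp_sum[symmetric] sum_distrib_left)
  then have "(\<integral>x. exp (\<i> * complex_of_real (t \<bullet> x)) * complex_of_real (gauss s x) \<partial>lborel) =
    (\<integral>x. (\<Prod>b\<in>Basis. exp (\<i> * complex_of_real ((t \<bullet> b) * (x \<bullet> b))) *
       complex_of_real (normal_density 0 s (x \<bullet> b))) \<partial>lborel)"
    by (simp add: gauss_def prod.distrib)
  also have "\<dots> = (\<Prod>b\<in>Basis. \<integral>x. exp (\<i> * complex_of_real ((t \<bullet> b) * x)) *
       complex_of_real (normal_density 0 s x) \<partial>lborel)"
  proof (intro integral_lborel_prod)
    fix b :: 'a
    have "integrable lborel (\<lambda>x. complex_of_real (normal_density 0 s x))"
      using assms by (auto intro: integrable_normal_density)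
    then show "integrable lborel (\<lambda>x. exp (\<i> * complex_of_real ((t \<bullet> b) * x)) *
       complex_of_real (normal_density 0 s x))"
      by (rule Bochner_Integration.integrable_bound) (auto simp: norm_mult simp del: of_real_mult)
  qed
  also have "\<dots> = complex_of_real (exp (\<Sum>b\<in>Basis. - (s * (t \<bullet> b))\<^sup>2 / 2))"
    by (simp only: integral_iexp_normal_density[OF assms] exp_sum[OF finite_Basis] of_real_prod)
  also have "(\<Sum>b\<in>Basis. - (s * (t \<bullet> b))\<^sup>2 / 2) = - (s * norm t)\<^sup>2 / 2"
  proof -
    have "(norm t)\<^sup>2 = (\<Sum>b\<in>Basis. (t \<bullet> b)\<^sup>2)"
      unfolding power2_norm_eq_inner by (subst euclidean_inner) (simp add: power2_eq_square)
    then show ?thesis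
      by (simp add: power_mult_distrib sum_distrib_left sum_divide_distrib sum_negf)
  qed
  finally show ?thesis .
qed

lemma integral_gauss [simp]:
  assumes "0 < s" shows "(\<integral>x. gauss s (x::'a::euclidean_space) \<partial>lborel) = 1"
  using integral_iexp_gauss[OF assms, of "0::'a"] by (simp flip: of_real_eq_iff)

text \<open>Two Fourier integrals contribute the squared constant on the left. The factor left over
  on the right is exactly the normalisation of \<open>gauss s\<close>, so that transforming
  \<open>gauss (1 / s)\<close> later yields the kernel \<open>gauss s\<close> with no stray
  constant.\<close>

lemma gauss_weight:
  fixes y :: "'a::euclidean_space"
  assumes "0 < s"
  shows "((2 * pi) powr (- real DIM('a) / 2))\<^sup>2 * exp (- (s * norm y)\<^sup>2 / 2) =
    (2 * pi * s\<^sup>2) powr (- real DIM('a) / 2) * gauss (1 / s) y"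
proof -
  have "(2 * pi * s\<^sup>2) powr (- real DIM('a) / 2) * (2 * pi * (1 / s)\<^sup>2) powr (- real DIM('a) / 2) =
    ((2 * pi) powr (- real DIM('a) / 2))\<^sup>2"
    using assms by (simp add: power2_eq_square flip: powr_mult)
  then show ?thesis
    using assms by (simp add: gauss_eq power_mult_distrib power_divide mult.assoc[symmetric])
qed

text \<open>The row and column conditions of Schur's test for the kernel
  \<open>gauss s (x - z)\<close>.\<close>

lemma nn_integral_gauss_diff:
  fixes x :: "'a::euclidean_space"
  assumes "0 < s"
  shows "(\<integral>\<^sup>+z. ennreal (gauss s (x - z)) \<partial>lborel) = 1"
    and "(\<integral>\<^sup>+z. ennreal (gauss s (z - x)) \<partial>lborel) = 1"
proof -
  have "(\<integral>\<^sup>+z. ennreal (gauss s (z - x)) \<partial>lborel) =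
    (\<integral>\<^sup>+z. ennreal (gauss s z) \<partial>distr lborel borel ((+) (- x)))"
    by (subst nn_integral_distr) simp_all
  also have "\<dots> = (\<integral>\<^sup>+z. ennreal (gauss s (z::'a)) \<partial>lborel)"
    by (simp add: lborel_distr_plus)
  also have "\<dots> = 1"
    using assms by (subst nn_integral_eq_integral) auto
  finally show 1: "(\<integral>\<^sup>+z. ennreal (gauss s (z - x)) \<partial>lborel) = 1" .
  have "gauss s (x - z) = gauss s (z - x)" for z
    using gauss_minus[of s "x - z"] by simp
  with 1 show "(\<integral>\<^sup>+z. ennreal (gauss s (x - z)) \<partial>lborel) = 1"
    by simp
qed

section \<open>The norm inequality for the Fourier integral\<close>

lemma (in pair_sigma_finite) integrable_mult_pair:
  fixes f g :: "_ \<Rightarrow> _::{real_normed_algebra, banach, second_countable_topology}"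
  assumes f: "integrable M1 f" and g: "integrable M2 g"
  shows "integrable (M1 \<Otimes>\<^sub>M M2) (\<lambda>p. f (fst p) * g (snd p))"
proof -
  note [measurable] = borel_measurable_integrable[OF f] borel_measurable_integrable[OF g]
  have "integrable (M1 \<Otimes>\<^sub>M M2) (\<lambda>p. norm (f (fst p)) * norm (g (snd p)))"
    using f g by (intro Fubini_integrable) auto
  then show ?thesis
    by (rule Bochner_Integration.integrable_bound) (auto simp: norm_mult_ineq)
qed

lemma fourier_int_measurable [measurable]:
  fixes u :: "real ^ 'n \<Rightarrow> complex"
  assumes [measurable]: "u \<in> borel_measurable borel"
  shows "fourier_int u \<in> borel_measurable borel"
  unfolding fourier_int_def[abs_def] by measurable

lemma integrable_iexp_mult:
  fixes u :: "'a::euclidean_space \<Rightarrow> complex"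
  assumes "integrable lborel u"
  shows "integrable lborel (\<lambda>x. exp (\<i> * complex_of_real (y \<bullet> x)) * u x)"
    and "integrable lborel (\<lambda>x. exp (- (\<i> * complex_of_real (y \<bullet> x))) * u x)"
proof -
  note [measurable] = borel_measurable_integrable[OF assms]
  show "integrable lborel (\<lambda>x. exp (\<i> * complex_of_real (y \<bullet> x)) * u x)"
    by (rule Bochner_Integration.integrable_bound[OF assms]) (auto simp: norm_mult)
  show "integrable lborel (\<lambda>x. exp (- (\<i> * complex_of_real (y \<bullet> x))) * u x)"
    by (rule Bochner_Integration.integrable_bound[OF assms]) (auto simp: norm_mult)
qed

text \<open>
  With \<open>w\<^sub>s(y) = exp (- s\<^sup>2\<bar>y\<bar>\<^sup>2 / 2)\<close>, Fubini turns the weighted \<open>L\<^sup>2\<close> norm of the transform into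
  a quadratic form whose kernel is a probability density in each variable, so that Schur's test
  applies with constant 1.
\<close>
lemma
  fixes u :: "real ^ 'n \<Rightarrow> complex"
  assumes u: "integrable lborel u" and s: "0 < s"
  shows integrable_fourier_weight:
      "integrable lborel (\<lambda>y. exp (- (s * norm y)\<^sup>2 / 2) * (cmod (fourier_int u y))\<^sup>2)" (is ?I)
    and integrable_gauss_form:
      "integrable (lborel \<Otimes>\<^sub>M lborel) (\<lambda>p. u (fst p) * cnj (u (snd p)) * complex_of_real (gauss s (fst p - snd p)))" (is ?J)
    and integral_fourier_weight:
      "complex_of_real (\<integral>y. exp (- (s * norm y)\<^sup>2 / 2) * (cmod (fourier_int u y))\<^sup>2 \<partial>lborel) =
       (\<integral>p. u (fst p) * cnj (u (snd p)) * complex_of_real (gauss s (fst p - snd p)) \<partial>(lborel \<Otimes>\<^sub>M lborel))" (is ?E)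
proof -
  note [measurable] = borel_measurable_integrable[OF u]
  interpret P: pair_sigma_finite "lborel :: (real ^ 'n) measure"
    "lborel \<Otimes>\<^sub>M lborel :: ((real ^ 'n) \<times> (real ^ 'n)) measure"
    by unfold_locales
  define c where "c = (2 * pi) powr (- real CARD('n) / 2)"
  define w where "w y = exp (- (s * norm y)\<^sup>2 / 2)" for y :: "real ^ 'n"
  define K where "K = (2 * pi * s\<^sup>2) powr (- real CARD('n) / 2)"
  \<comment> \<open>The frequency \<open>y\<close> and the pair \<open>p\<close> of space variables
    are integrated in both orders: \<open>p\<close> first gives the weighted square of the transform
    (\<open>inner\<close>), \<open>y\<close> first gives the Gaussian kernel (\<open>outer\<close>).
    The weight \<open>w\<close> is what makes \<open>H\<close> absolutely integrable.\<close>
  define H where "H y p = complex_of_real (c\<^sup>2 * w y) *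
      ((exp (- (\<i> * complex_of_real (y \<bullet> fst p))) * u (fst p)) *
       (exp (\<i> * complex_of_real (y \<bullet> snd p)) * cnj (u (snd p))))" for y :: "real ^ 'n" and p
  have [measurable]: "w \<in> borel_measurable borel"
    unfolding w_def[abs_def] by measurable
  have cw: "c\<^sup>2 * w y = K * gauss (1 / s) y" for y
    using gauss_weight[OF s, of y] by (simp add: c_def w_def K_def)
  have cnju: "integrable lborel (\<lambda>x. cnj (u x))"
    using u by simp
  have int_cw: "integrable lborel (\<lambda>y. complex_of_real (c\<^sup>2 * w y))"
    using s unfolding cw by (intro integrable_of_real integrable_mult_right integrable_gauss) simp
  have [measurable]: "cnj \<in> borel_measurable borel"
    by (intro borel_measurable_continuous_onI continuous_intros)
  have H_meas: "case_prod H \<in> borel_measurable (lborel \<Otimes>\<^sub>M (lborel \<Otimes>\<^sub>M lborel))"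
    unfolding H_def by measurable
  have int_H: "integrable (lborel \<Otimes>\<^sub>M (lborel \<Otimes>\<^sub>M lborel)) (case_prod H)"
  proof (rule Bochner_Integration.integrable_bound[OF P.integrable_mult_pair[OF int_cw
        lborel_pair.integrable_mult_pair[OF u cnju]] H_meas])
  qed (auto simp: H_def norm_mult)
  have inner: "(\<integral>p. H y p \<partial>(lborel \<Otimes>\<^sub>M lborel)) = complex_of_real (w y * (cmod (fourier_int u y))\<^sup>2)" for y
  proof -
    let ?a = "\<lambda>x. exp (- (\<i> * complex_of_real (y \<bullet> x))) * u x"
    let ?b = "\<lambda>x. exp (\<i> * complex_of_real (y \<bullet> x)) * cnj (u x)"
    have ab: "integrable (lborel \<Otimes>\<^sub>M lborel) (\<lambda>p. ?a (fst p) * ?b (snd p))"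
      by (intro lborel_pair.integrable_mult_pair integrable_iexp_mult u cnju)
    have "(\<integral>p. ?a (fst p) * ?b (snd p) \<partial>(lborel \<Otimes>\<^sub>M lborel)) =
        (\<integral>x. (\<integral>z. ?a x * ?b z \<partial>lborel) \<partial>lborel)"
      using lborel_pair.integral_fst'[OF ab] by simp
    also have "\<dots> = (\<integral>x. ?a x \<partial>lborel) * (\<integral>z. ?b z \<partial>lborel)"
      by (simp only: integral_mult_right_zero integral_mult_left_zero)
    also have "(\<integral>z. ?b z \<partial>lborel) = cnj (\<integral>x. ?a x \<partial>lborel)"
      by (subst Bochner_Integration.integral_cnj[symmetric]) (simp add: exp_cnj)
    finally have "(\<integral>p. ?a (fst p) * ?b (snd p) \<partial>(lborel \<Otimes>\<^sub>M lborel)) =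
        complex_of_real ((cmod (\<integral>x. ?a x \<partial>lborel))\<^sup>2)"
      by (simp only: complex_norm_square)
    moreover have "cmod (fourier_int u y) = c * cmod (\<integral>x. ?a x \<partial>lborel)"
      by (simp add: fourier_int_def c_def norm_mult)
    ultimately show ?thesis
      unfolding H_def by (simp only: integral_mult_right_zero) (simp add: power_mult_distrib)
  qed
  have outer: "(\<integral>y. H y p \<partial>lborel) = u (fst p) * cnj (u (snd p)) * complex_of_real (gauss s (fst p - snd p))" for p
  proof -
    let ?t = "snd p - fst p"
    have "H y p = (u (fst p) * cnj (u (snd p)) * complex_of_real K) *
        (exp (\<i> * complex_of_real (?t \<bullet> y)) * complex_of_real (gauss (1 / s) y))" for y
    proof -
      have "exp (\<i> * complex_of_real (?t \<bullet> y)) =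
          exp (\<i> * complex_of_real (y \<bullet> snd p)) * exp (- (\<i> * complex_of_real (y \<bullet> fst p)))"
        unfolding exp_add[symmetric] by (simp add: inner_commute inner_diff_right right_diff_distrib)
      then show ?thesis
        unfolding H_def cw by (simp add: ac_simps)
    qed
    then have eq: "(\<integral>y. H y p \<partial>lborel) = (u (fst p) * cnj (u (snd p)) * complex_of_real K) *
        complex_of_real (exp (- (1 / s * norm ?t)\<^sup>2 / 2))"
      using s by (simp only: integral_mult_right_zero integral_iexp_gauss[of "1 / s"] zero_less_divide_1_iff)
    have "K * exp (- (1 / s * norm ?t)\<^sup>2 / 2) = gauss s (fst p - snd p)"
      using s by (simp add: gauss_eq K_def power_divide norm_minus_commute)
    then have "complex_of_real K * complex_of_real (exp (- (1 / s * norm ?t)\<^sup>2 / 2)) =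
        complex_of_real (gauss s (fst p - snd p))"
      by (simp only: flip: of_real_mult)
    then show ?thesis
      unfolding eq mult.assoc by (simp only:)
  qed
  have "integrable lborel (\<lambda>y. complex_of_real (w y * (cmod (fourier_int u y))\<^sup>2))"
    using P.integrable_fst[OF int_H] by (simp only: inner)
  then show ?I
    by (simp only: complex_of_real_integrable_eq w_def)
  show ?J
    using P.integrable_snd[OF int_H] by (simp only: outer)
  show ?E
    using P.integral_fst[OF int_H] P.integral_snd[OF int_H]
    by (simp only: inner outer integral_complex_of_real w_def)
qed

text \<open>Schur's test by hand: \<open>a * b \<le> a^2 / 2 + b^2 / 2\<close> splits the quadratic
  form into two halves, and each half integrates the kernel over the variable on which its square
  does not depend. All bounds are taken in [0, infinity], so \<open>u\<close> need not be square
  integrable.\<close>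

lemma nn_integral_fourier_weight_le:
  fixes u :: "real ^ 'n \<Rightarrow> complex"
  assumes u: "integrable lborel u" and s: "0 < s"
  shows "(\<integral>\<^sup>+y. ennreal (exp (- (s * norm y)\<^sup>2 / 2) * (cmod (fourier_int u y))\<^sup>2) \<partial>lborel)
    \<le> (\<integral>\<^sup>+x. ennreal ((cmod (u x))\<^sup>2) \<partial>lborel)"
proof -
  note [measurable] = borel_measurable_integrable[OF u]
  let ?A = "\<integral>\<^sup>+x. ennreal ((cmod (u x))\<^sup>2) \<partial>lborel"
  let ?B = "\<integral>y. exp (- (s * norm y)\<^sup>2 / 2) * (cmod (fourier_int u y))\<^sup>2 \<partial>lborel"
  have B: "0 \<le> ?B"
    by (intro Bochner_Integration.integral_nonneg) auto
  have "(\<integral>\<^sup>+y. ennreal (exp (- (s * norm y)\<^sup>2 / 2) * (cmod (fourier_int u y))\<^sup>2) \<partial>lborel) = ennreal ?B"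
    by (intro nn_integral_eq_integral integrable_fourier_weight u s) auto
  also have "?B = cmod (complex_of_real ?B)"
    using B by simp
  also have "ennreal (cmod (complex_of_real ?B)) \<le> (\<integral>\<^sup>+p. ennreal (cmod (u (fst p) * cnj (u (snd p)) *
      complex_of_real (gauss s (fst p - snd p)))) \<partial>(lborel \<Otimes>\<^sub>M lborel))"
    unfolding integral_fourier_weight[OF u s]
    by (intro integral_norm_bound_ennreal integrable_gauss_form u s)
  also have "\<dots> \<le> (\<integral>\<^sup>+p. ennreal (1 / 2 * (cmod (u (fst p)))\<^sup>2) * ennreal (gauss s (fst p - snd p)) +
      ennreal (1 / 2 * (cmod (u (snd p)))\<^sup>2) * ennreal (gauss s (fst p - snd p)) \<partial>(lborel \<Otimes>\<^sub>M lborel))"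
  proof (intro nn_integral_mono)
    fix p :: "(real ^ 'n) \<times> (real ^ 'n)"
    let ?a = "cmod (u (fst p))" and ?b = "cmod (u (snd p))" and ?g = "gauss s (fst p - snd p)"
    have "?a * ?b \<le> 1 / 2 * ?a\<^sup>2 + 1 / 2 * ?b\<^sup>2"
      using sum_squares_bound[of ?a ?b] by simp
    then have "?a * ?b * ?g \<le> (1 / 2 * ?a\<^sup>2 + 1 / 2 * ?b\<^sup>2) * ?g"
      by (intro mult_right_mono) auto
    then show "ennreal (cmod (u (fst p) * cnj (u (snd p)) * complex_of_real ?g))
        \<le> ennreal (1 / 2 * ?a\<^sup>2) * ennreal ?g + ennreal (1 / 2 * ?b\<^sup>2) * ennreal ?g"
      by (simp add: norm_mult distrib_right flip: ennreal_mult ennreal_plus)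
  qed
  also have "\<dots> = (\<integral>\<^sup>+x. (\<integral>\<^sup>+z. ennreal (1 / 2 * (cmod (u x))\<^sup>2) * ennreal (gauss s (x - z)) \<partial>lborel) \<partial>lborel) +
      (\<integral>\<^sup>+z. (\<integral>\<^sup>+x. ennreal (1 / 2 * (cmod (u z))\<^sup>2) * ennreal (gauss s (x - z)) \<partial>lborel) \<partial>lborel)"
    by (subst nn_integral_add, simp, simp)
      (subst lborel.nn_integral_fst[symmetric], simp, subst lborel_pair.nn_integral_snd[symmetric], simp, simp)
  also have "\<dots> = (\<integral>\<^sup>+x. ennreal (1 / 2 * (cmod (u x))\<^sup>2) \<partial>lborel) + (\<integral>\<^sup>+x. ennreal (1 / 2 * (cmod (u x))\<^sup>2) \<partial>lborel)"
  proof -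
    have "(\<integral>\<^sup>+z. C * ennreal (gauss s (x - z)) \<partial>lborel) = C" "(\<integral>\<^sup>+z. C * ennreal (gauss s (z - x)) \<partial>lborel) = C"
      for C and x :: "real ^ 'n"
      by (simp_all add: nn_integral_cmult nn_integral_gauss_diff[OF s])
    then show ?thesis
      by (simp only:)
  qed
  also have "\<dots> = (\<integral>\<^sup>+x. ennreal (1 / 2 * (cmod (u x))\<^sup>2) + ennreal (1 / 2 * (cmod (u x))\<^sup>2) \<partial>lborel)"
    by (rule nn_integral_add[symmetric]) simp_all
  also have "\<dots> = ?A"
    by (intro nn_integral_cong) (simp flip: ennreal_plus)
  finally show ?thesis .
qed

text \<open>Fatou's lemma removes the weight as \<open>s = 1 / (k + 1)\<close> tends to 0, since the
  bound is uniform in \<open>s\<close>.\<close>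

lemma fourier_int_L2_le:
  fixes u :: "real ^ 'n \<Rightarrow> complex"
  assumes u: "integrable lborel u"
  shows "(\<integral>\<^sup>+y. ennreal ((cmod (fourier_int u y))\<^sup>2) \<partial>lborel) \<le> (\<integral>\<^sup>+x. ennreal ((cmod (u x))\<^sup>2) \<partial>lborel)"
proof -
  note [measurable] = borel_measurable_integrable[OF u]
  let ?f = "\<lambda>k y. ennreal (exp (- (inverse (real (Suc k)) * norm y)\<^sup>2 / 2) * (cmod (fourier_int u y))\<^sup>2)"
  have "(\<lambda>k. ?f k y) \<longlonglongrightarrow> ennreal (exp (- (0 * norm y)\<^sup>2 / 2) * (cmod (fourier_int u y))\<^sup>2)" for y
    by (intro tendsto_intros tendsto_ennrealI LIMSEQ_inverse_real_of_nat) simp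
  then have "liminf (\<lambda>k. ?f k y) = ennreal ((cmod (fourier_int u y))\<^sup>2)" for y
    by (intro lim_imp_Liminf) simp_all
  then have "(\<integral>\<^sup>+y. ennreal ((cmod (fourier_int u y))\<^sup>2) \<partial>lborel) = (\<integral>\<^sup>+y. liminf (\<lambda>k. ?f k y) \<partial>lborel)"
    by simp
  also have "\<dots> \<le> liminf (\<lambda>k. \<integral>\<^sup>+y. ?f k y \<partial>lborel)"
    by (intro nn_integral_liminf) simp
  also have "\<dots> \<le> liminf (\<lambda>k::nat. \<integral>\<^sup>+x. ennreal ((cmod (u x))\<^sup>2) \<partial>lborel)"
    by (intro Liminf_mono always_eventually allI nn_integral_fourier_weight_le u) simp
  also have "\<dots> = (\<integral>\<^sup>+x. ennreal ((cmod (u x))\<^sup>2) \<partial>lborel)"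
    by (simp add: Liminf_const)
  finally show ?thesis .
qed

lemma inv_fourier_int_eq: "inv_fourier_int u = (\<lambda>y. fourier_int u (- y))"
  by (simp add: fun_eq_iff fourier_int_def inv_fourier_int_def)

lemma inv_fourier_int_L2_le:
  fixes u :: "real ^ 'n \<Rightarrow> complex"
  assumes u: "integrable lborel u"
  shows "(\<integral>\<^sup>+y. ennreal ((cmod (inv_fourier_int u y))\<^sup>2) \<partial>lborel) \<le> (\<integral>\<^sup>+x. ennreal ((cmod (u x))\<^sup>2) \<partial>lborel)"
proof -
  note [measurable] = borel_measurable_integrable[OF u]
  have "distr lborel borel uminus = (lborel :: (real ^ 'n) measure)"
    by (subst (2) lborel_affine[of "-1" 0]) (simp_all add: density_1)
  then have "(\<integral>\<^sup>+y. ennreal ((cmod (fourier_int u y))\<^sup>2) \<partial>lborel) =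
    (\<integral>\<^sup>+y. ennreal ((cmod (fourier_int u y))\<^sup>2) \<partial>distr lborel borel uminus)"
    by simp
  also have "\<dots> = (\<integral>\<^sup>+y. ennreal ((cmod (inv_fourier_int u y))\<^sup>2) \<partial>lborel)"
    by (subst nn_integral_distr) (simp_all add: inv_fourier_int_eq)
  finally show ?thesis
    using fourier_int_L2_le[OF u] by simp
qed

section \<open>Square integrable functions\<close>

text \<open>The square of the distance, to match the integrals in \<open>L2_limit\<close>, with
  infinity as a legitimate value. The price is a triangle inequality with factors 2, which is
  harmless for limits and for finiteness.\<close>

definition L2_dist2 :: "(real ^ 'n \<Rightarrow> complex) \<Rightarrow> (real ^ 'n \<Rightarrow> complex) \<Rightarrow> ennreal" where
  "L2_dist2 f g = (\<integral>\<^sup>+x. ennreal ((cmod (f x - g x))\<^sup>2) \<partial>lborel)"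

lemma L2_dist2_commute: "L2_dist2 f g = L2_dist2 g f"
  by (simp add: L2_dist2_def norm_minus_commute)

lemma cmod_add_sq_le: "(cmod (a + b))\<^sup>2 \<le> 2 * (cmod a)\<^sup>2 + 2 * (cmod b)\<^sup>2"
proof -
  have "(cmod (a + b))\<^sup>2 \<le> (cmod a + cmod b)\<^sup>2"
    by (intro power_mono norm_triangle_ineq) simp
  also have "\<dots> \<le> 2 * (cmod a)\<^sup>2 + 2 * (cmod b)\<^sup>2"
    using sum_squares_bound[of "cmod a" "cmod b"] by (simp add: power2_sum)
  finally show ?thesis .
qed

lemma L2_dist2_triangle:
  assumes [measurable]: "f \<in> borel_measurable borel" "g \<in> borel_measurable borel" "h \<in> borel_measurable borel"
  shows "L2_dist2 f h \<le> 2 * L2_dist2 f g + 2 * L2_dist2 g h"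
proof -
  have "L2_dist2 f h \<le> (\<integral>\<^sup>+x. 2 * ennreal ((cmod (f x - g x))\<^sup>2) + 2 * ennreal ((cmod (g x - h x))\<^sup>2) \<partial>lborel)"
    unfolding L2_dist2_def
  proof (intro nn_integral_mono)
    fix x
    have "ennreal ((cmod (f x - h x))\<^sup>2) \<le> ennreal (2 * (cmod (f x - g x))\<^sup>2 + 2 * (cmod (g x - h x))\<^sup>2)"
      using cmod_add_sq_le[of "f x - g x" "g x - h x"] by (intro ennreal_leI) simp
    then show "ennreal ((cmod (f x - h x))\<^sup>2) \<le> 2 * ennreal ((cmod (f x - g x))\<^sup>2) + 2 * ennreal ((cmod (g x - h x))\<^sup>2)"
      by (simp add: ennreal_mult)
  qed
  also have "\<dots> = 2 * L2_dist2 f g + 2 * L2_dist2 g h"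
    by (simp add: nn_integral_add nn_integral_cmult L2_dist2_def)
  finally show ?thesis .
qed

lemma L2_scalar_iff: "L2_scalar f \<longleftrightarrow> f \<in> borel_measurable borel \<and> L2_dist2 f (\<lambda>_. 0) < \<infinity>"
  by (auto simp: L2_scalar_def L2_dist2_def integrable_iff_bounded)

lemma L2_dist2_eq_0_iff:
  assumes [measurable]: "f \<in> borel_measurable borel" "g \<in> borel_measurable borel"
  shows "L2_dist2 f g = 0 \<longleftrightarrow> (AE x in lborel. f x = g x)"
  unfolding L2_dist2_def by (subst nn_integral_0_iff_AE) (simp_all add: ennreal_eq_0_iff)

lemma L2_dist2_mult: "L2_dist2 (\<lambda>x. a * f x) (\<lambda>x. a * g x) = ennreal ((cmod a)\<^sup>2) * L2_dist2 f g"
  if [measurable]: "f \<in> borel_measurable borel" "g \<in> borel_measurable borel"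
proof -
  have "ennreal ((cmod (a * f x - a * g x))\<^sup>2) = ennreal ((cmod a)\<^sup>2) * ennreal ((cmod (f x - g x))\<^sup>2)" for x
    by (simp add: norm_mult power_mult_distrib flip: right_diff_distrib ennreal_mult)
  then show ?thesis
    unfolding L2_dist2_def by (simp add: nn_integral_cmult)
qed

lemma L2_scalar_add:
  assumes "L2_scalar f" "L2_scalar g" shows "L2_scalar (\<lambda>x. f x + g x)"
proof -
  have [measurable]: "f \<in> borel_measurable borel" "g \<in> borel_measurable borel"
    using assms by (auto simp: L2_scalar_iff)
  have "L2_dist2 (\<lambda>x. f x + g x) (\<lambda>_. 0) \<le> 2 * L2_dist2 (\<lambda>x. f x + g x) g + 2 * L2_dist2 g (\<lambda>_. 0)"
    by (intro L2_dist2_triangle) measurable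
  also have "L2_dist2 (\<lambda>x. f x + g x) g = L2_dist2 f (\<lambda>_. 0)"
    by (simp add: L2_dist2_def)
  also have "2 * L2_dist2 f (\<lambda>_. 0) + 2 * L2_dist2 g (\<lambda>_. 0) < \<infinity>"
    using assms by (simp add: L2_scalar_iff ennreal_mult_less_top)
  finally show ?thesis
    by (simp add: L2_scalar_iff)
qed

lemma L2_scalar_mult_bounded:
  assumes f: "L2_scalar f" and [measurable]: "h \<in> borel_measurable borel" and h: "\<And>x. cmod (h x) \<le> C"
  shows "L2_scalar (\<lambda>x. f x * h x)"
    and "L2_dist2 (\<lambda>x. f x * h x) (\<lambda>_. 0) \<le> ennreal (C\<^sup>2) * L2_dist2 f (\<lambda>_. 0)"
proof -
  have [measurable]: "f \<in> borel_measurable borel"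
    using f by (auto simp: L2_scalar_iff)
  have "ennreal ((cmod (f x * h x - 0))\<^sup>2) \<le> ennreal (C\<^sup>2) * ennreal ((cmod (f x - 0))\<^sup>2)" for x
    using mult_right_mono[OF power_mono[OF h, of x 2], of "(cmod (f x))\<^sup>2"]
    by (simp add: norm_mult power_mult_distrib mult.commute[of "(cmod (f x))\<^sup>2"] flip: ennreal_mult)
  then have "L2_dist2 (\<lambda>x. f x * h x) (\<lambda>_. 0) \<le> (\<integral>\<^sup>+x. ennreal (C\<^sup>2) * ennreal ((cmod (f x - 0))\<^sup>2) \<partial>lborel)"
    unfolding L2_dist2_def by (intro nn_integral_mono)
  then show *: "L2_dist2 (\<lambda>x. f x * h x) (\<lambda>_. 0) \<le> ennreal (C\<^sup>2) * L2_dist2 f (\<lambda>_. 0)"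
    unfolding L2_dist2_def by (simp add: nn_integral_cmult)
  also have "\<dots> < \<infinity>"
    using f by (simp add: L2_scalar_iff ennreal_mult_less_top)
  finally show "L2_scalar (\<lambda>x. f x * h x)"
    by (simp add: L2_scalar_iff)
qed

lemma L2_scalar_cmult: "L2_scalar f \<Longrightarrow> L2_scalar (\<lambda>x. a * f x)"
  using L2_scalar_mult_bounded(1)[of f "\<lambda>_. a" "cmod a"] by (simp add: mult.commute)

lemma L2_scalar_zero [simp]: "L2_scalar (\<lambda>_. 0)"
  by (simp add: L2_scalar_def)

lemma L2_scalar_sum: "(\<And>i. i \<in> I \<Longrightarrow> L2_scalar (f i)) \<Longrightarrow> L2_scalar (\<lambda>x. \<Sum>i\<in>I. f i x)"
  by (induction I rule: infinite_finite_induct) (auto intro: L2_scalar_add)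

lemma tendsto_0_le_ennreal:
  fixes f g :: "nat \<Rightarrow> ennreal"
  assumes "g \<longlonglongrightarrow> 0" "\<And>k. f k \<le> g k"
  shows "f \<longlonglongrightarrow> 0"
  by (rule tendsto_sandwich[OF _ _ tendsto_const assms(1)]) (simp_all add: assms(2))

text \<open>
  The weights \<open>2\<^sup>k\<close> replace Minkowski's inequality: \<open>\<Sum>k. 2\<^sup>k \<bar>v\<^sub>k\<^sub>+\<^sub>1 - v\<^sub>k\<bar>\<^sup>2\<close> is integrable, which forces
  geometric decay of the increments almost everywhere.
\<close>
lemma L2_complete:
  fixes v :: "nat \<Rightarrow> real ^ 'n \<Rightarrow> complex"
  assumes v: "\<And>k. L2_scalar (v k)"
    and C: "\<And>i j. L2_dist2 (v i) (v j) \<le> ennreal (C * ((1 / 4) ^ i + (1 / 4) ^ j))"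
  obtains g where "L2_scalar g" "(\<lambda>k. L2_dist2 (v k) g) \<longlonglongrightarrow> 0"
proof -
  have [measurable]: "v k \<in> borel_measurable borel" for k
    using v by (simp add: L2_scalar_iff)
  define d where "d k x = v (Suc k) x - v k x" for k x
  have [measurable]: "d k \<in> borel_measurable borel" for k
    unfolding d_def[abs_def] by measurable
  \<comment> \<open>\<open>ennreal\<close> truncates negative reals to 0; a nonnegative constant
    keeps the real arithmetic inside it faithful.\<close>
  define D where "D = max C 0"
  have D: "0 \<le> D" "C * ((1 / 4) ^ i + (1 / 4) ^ j) \<le> D * ((1 / 4) ^ i + (1 / 4) ^ j)" for i j
    unfolding D_def by (auto intro!: mult_right_mono)
  have two: "2 ^ k * ennreal r = ennreal (2 ^ k * r)" if "0 \<le> r" for k r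
    using that by (subst ennreal_mult) (simp_all flip: ennreal_power)
  \<comment> \<open>The rate \<open>4^(-k)\<close> in the hypothesis absorbs the weight
    \<open>2^k\<close> and still leaves a summable \<open>2^(-k)\<close>. The factor 2 rounds up 1 +
    1/4.\<close>
  have bound: "(\<integral>\<^sup>+x. 2 ^ k * ennreal ((cmod (d k x))\<^sup>2) \<partial>lborel) \<le> ennreal (2 * D * (1 / 2) ^ k)" for k
  proof -
    have "(\<integral>\<^sup>+x. 2 ^ k * ennreal ((cmod (d k x))\<^sup>2) \<partial>lborel) = 2 ^ k * L2_dist2 (v (Suc k)) (v k)"
      by (simp add: nn_integral_cmult L2_dist2_def d_def)
    also have "\<dots> \<le> 2 ^ k * ennreal (D * ((1 / 4) ^ Suc k + (1 / 4) ^ k))"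
      by (intro mult_left_mono order_trans[OF C] ennreal_leI D) simp
    also have "\<dots> = ennreal (2 ^ k * (D * ((1 / 4) ^ Suc k + (1 / 4) ^ k)))"
      using D(1) by (intro two) auto
    also have "2 ^ k * (D * ((1 / 4) ^ Suc k + (1 / 4) ^ k)) = 5 / 4 * D * (2 ^ k * (1 / 4) ^ k)"
      by (simp add: algebra_simps)
    also have "(2::real) ^ k * (1 / 4) ^ k = (1 / 2) ^ k"
      by (simp flip: power_mult_distrib)
    also have "ennreal (5 / 4 * D * (1 / 2) ^ k) \<le> ennreal (2 * D * (1 / 2) ^ k)"
      using D(1) by (intro ennreal_leI mult_right_mono) auto
    finally show ?thesis .
  qed
  have "(\<integral>\<^sup>+x. (\<Sum>k. 2 ^ k * ennreal ((cmod (d k x))\<^sup>2)) \<partial>lborel) =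
      (\<Sum>k. \<integral>\<^sup>+x. 2 ^ k * ennreal ((cmod (d k x))\<^sup>2) \<partial>lborel)"
    by (rule nn_integral_suminf) simp
  also have "\<dots> \<le> (\<Sum>k. ennreal (2 * D * (1 / 2) ^ k))"
    by (intro suminf_le bound summableI)
  also have "\<dots> < \<infinity>"
    using D(1) by (subst suminf_ennreal2) (auto intro!: summable_mult summable_geometric)
  finally have "AE x in lborel. (\<Sum>k. 2 ^ k * ennreal ((cmod (d k x))\<^sup>2)) \<noteq> \<infinity>"
    by (intro nn_integral_PInf_AE) auto
  then have conv: "AE x in lborel. convergent (\<lambda>k. v k x)"
  proof eventually_elim
    case (elim x)
    \<comment> \<open>The series is finite at this \<open>x\<close>, so \<open>B\<close> is its true
      value. Each single term is at most \<open>B\<close>, whence the increments are bounded by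
      \<open>sqrt B * 2^(-k/2)\<close>.\<close>
    define B where "B = enn2real (\<Sum>k. 2 ^ k * ennreal ((cmod (d k x))\<^sup>2))"
    have "2 ^ k * (cmod (d k x))\<^sup>2 \<le> B" for k
    proof -
      have "(\<Sum>i\<in>{k}. 2 ^ i * ennreal ((cmod (d i x))\<^sup>2)) \<le> (\<Sum>k. 2 ^ k * ennreal ((cmod (d k x))\<^sup>2))"
        by (intro sum_le_suminf summableI) auto
      then have "ennreal (2 ^ k * (cmod (d k x))\<^sup>2) \<le> ennreal B"
        using elim by (simp add: B_def two ennreal_enn2real_if)
      then show ?thesis
        by (subst (asm) ennreal_le_iff) (auto simp: B_def)
    qed
    then have le: "cmod (d k x) \<le> sqrt B * (sqrt (1 / 2)) ^ k" for k
    proof -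
      have "(cmod (d k x))\<^sup>2 \<le> B * (1 / 2) ^ k"
        using \<open>2 ^ k * (cmod (d k x))\<^sup>2 \<le> B\<close> by (simp add: power_divide field_simps)
      then have "cmod (d k x) \<le> sqrt (B * (1 / 2) ^ k)"
        by (rule real_le_rsqrt)
      then show ?thesis
        by (simp only: real_sqrt_mult real_sqrt_power)
    qed
    have "summable (\<lambda>k. sqrt B * (sqrt (1 / 2)) ^ k)"
      by (intro summable_mult summable_geometric) (simp add: real_sqrt_divide)
    then have "summable (\<lambda>k. d k x)"
      by (rule summable_comparison_test') (rule le)
    then have "convergent (\<lambda>k. (\<Sum>i<k. v (Suc i) x - v i x) + v 0 x)"
      unfolding d_def summable_iff_convergent by (intro convergent_add convergent_const)
    then show ?case
      by (simp only: sum_lessThan_telescope[of "\<lambda>i. v i x"] diff_add_cancel)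
  qed
  \<comment> \<open>Where the sequence diverges this value is unspecified, but by
    \<open>conv\<close> that happens only on a null set.\<close>
  define g where "g x = lim (\<lambda>k. v k x)" for x
  have [measurable]: "g \<in> borel_measurable borel"
    unfolding g_def[abs_def] by measurable
  \<comment> \<open>Fatou's lemma in the tail index \<open>j\<close>: the distance to the pointwise
    limit is at most the lower limit of the distances to later members, so the Cauchy rate is
    inherited.\<close>
  have le: "L2_dist2 (v k) g \<le> ennreal (2 * D * (1 / 4) ^ k)" for k
  proof -
    have "L2_dist2 (v k) g = (\<integral>\<^sup>+x. liminf (\<lambda>j. ennreal ((cmod (v k x - v (k + j) x))\<^sup>2)) \<partial>lborel)"
      unfolding L2_dist2_def
    proof (rule nn_integral_cong_AE, use conv in eventually_elim)
      case (elim x)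
      then have "(\<lambda>j. v j x) \<longlonglongrightarrow> g x"
        by (simp add: g_def convergent_LIMSEQ_iff)
      then have "(\<lambda>j. v (k + j) x) \<longlonglongrightarrow> g x"
        using LIMSEQ_ignore_initial_segment[of _ _ k] by (simp add: add.commute)
      then have "(\<lambda>j. ennreal ((cmod (v k x - v (k + j) x))\<^sup>2)) \<longlonglongrightarrow> ennreal ((cmod (v k x - g x))\<^sup>2)"
        by (intro tendsto_ennrealI tendsto_intros)
      then show ?case
        by (intro lim_imp_Liminf[symmetric]) simp_all
    qed
    also have "\<dots> \<le> liminf (\<lambda>j. \<integral>\<^sup>+x. ennreal ((cmod (v k x - v (k + j) x))\<^sup>2) \<partial>lborel)"
      by (intro nn_integral_liminf) simp
    also have "\<dots> \<le> liminf (\<lambda>j::nat. ennreal (2 * D * (1 / 4) ^ k))"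
    proof (intro Liminf_mono always_eventually allI)
      fix j
      have "(1 / 4 :: real) ^ (k + j) \<le> (1 / 4) ^ k"
        by (intro power_decreasing) auto
      then have "D * ((1 / 4) ^ k + (1 / 4) ^ (k + j)) \<le> D * (2 * (1 / 4) ^ k)"
        using D(1) by (intro mult_left_mono) auto
      then show "(\<integral>\<^sup>+x. ennreal ((cmod (v k x - v (k + j) x))\<^sup>2) \<partial>lborel) \<le> ennreal (2 * D * (1 / 4) ^ k)"
        using order_trans[OF C[of k "k + j"] ennreal_leI[OF D(2)]] unfolding L2_dist2_def
        by (elim order_trans) (auto intro!: ennreal_leI simp: mult_ac)
    qed
    also have "\<dots> = ennreal (2 * D * (1 / 4) ^ k)"
      by (simp add: Liminf_const)
    finally show ?thesis .
  qed
  show ?thesis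
  proof
    have "L2_dist2 g (\<lambda>_. 0) \<le> 2 * L2_dist2 g (v 0) + 2 * L2_dist2 (v 0) (\<lambda>_. 0)"
      by (intro L2_dist2_triangle) simp_all
    also have "\<dots> < \<infinity>"
      using v[of 0] order_le_less_trans[OF le[of 0]] by (simp add: L2_scalar_iff ennreal_mult_less_top L2_dist2_commute[of g])
    finally show "L2_scalar g"
      by (simp add: L2_scalar_iff)
    have "(\<lambda>k. ennreal (2 * D * (1 / 4) ^ k)) \<longlonglongrightarrow> ennreal (2 * D * 0)"
      by (intro tendsto_ennrealI tendsto_intros LIMSEQ_power_zero) simp
    then show "(\<lambda>k. L2_dist2 (v k) g) \<longlonglongrightarrow> 0"
      by (intro tendsto_0_le_ennreal[OF _ le]) simp
  qed
qed

text \<open>Truncation to growing balls converges by dominated convergence; suitable truncations are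
  then picked to obtain the rate that \<open>L2_complete\<close> requires.\<close>

lemma L2_L1_approx:
  fixes f :: "real ^ 'n \<Rightarrow> complex"
  assumes f: "L2_scalar f"
  obtains u where "\<And>k. integrable lborel (u k)" "\<And>k. L2_scalar (u k)"
    "\<And>k::nat. L2_dist2 (u k) f \<le> ennreal ((1 / 4) ^ k)"
proof -
  have [measurable]: "f \<in> borel_measurable borel"
    and f2: "integrable lborel (\<lambda>x. (cmod (f x))\<^sup>2)"
    using f by (simp_all add: L2_scalar_def)
  define w where "w k x = f x * of_real (indicator (cball 0 (real k)) x)" for k x
  have [measurable]: "cball (0 :: real ^ 'n) (real k) \<in> sets borel" for k
    by simp
  have [measurable]: "w k \<in> borel_measurable borel" for k
    unfolding w_def[abs_def] by measurable
  have w1: "integrable lborel (w k)" for k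
  proof (rule Bochner_Integration.integrable_bound)
    show "integrable lborel (\<lambda>x. (cmod (f x))\<^sup>2 + indicator (cball (0 :: real ^ 'n) (real k)) x :: real)"
      using f2 by (intro Bochner_Integration.integrable_add integrable_real_indicator emeasure_lborel_cball_finite) auto
    \<comment> \<open>On a ball, which has finite measure, this bounds \<open>cmod (f x)\<close> by
      an integrable function.\<close>
    have "a \<le> a\<^sup>2 + 1" for a :: real
      using sum_squares_bound[of a "1/2"] by (simp add: power2_eq_square)
    then show "AE x in lborel. norm (w k x) \<le> norm ((cmod (f x))\<^sup>2 + indicator (cball 0 (real k)) x :: real)"
      by (auto simp: w_def norm_mult split: split_indicator)
  qed simp
  have w2: "L2_scalar (w k)" for k
    unfolding w_def by (rule L2_scalar_mult_bounded(1)[OF f, where C=1]) (auto split: split_indicator)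
  have "(\<lambda>k. \<integral>\<^sup>+x. ennreal ((cmod (w k x - f x))\<^sup>2) \<partial>lborel) \<longlonglongrightarrow> (\<integral>\<^sup>+x. 0 \<partial>(lborel :: (real ^ 'n) measure))"
  proof (rule nn_integral_dominated_convergence)
    show "(\<integral>\<^sup>+x. ennreal ((cmod (f x))\<^sup>2) \<partial>lborel) < \<infinity>"
      using f by (simp add: L2_scalar_iff L2_dist2_def)
    show "AE x in lborel. ennreal ((cmod (w k x - f x))\<^sup>2) \<le> ennreal ((cmod (f x))\<^sup>2)" for k
      by (auto simp: w_def intro!: AE_I2 split: split_indicator)
    show "AE x in lborel. (\<lambda>k. ennreal ((cmod (w k x - f x))\<^sup>2)) \<longlonglongrightarrow> 0"
    proof (rule AE_I2)
      fix x :: "real ^ 'n"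
      obtain K :: nat where K: "norm x \<le> real K"
        using real_arch_simple by blast
      have "ennreal ((cmod (w k x - f x))\<^sup>2) = 0" if "K \<le> k" for k
        using K that by (auto simp: w_def indicator_def)
      then show "(\<lambda>k. ennreal ((cmod (w k x - f x))\<^sup>2)) \<longlonglongrightarrow> 0"
        by (intro tendsto_eventually eventually_sequentiallyI)
    qed
  qed auto
  then have lim: "(\<lambda>k. L2_dist2 (w k) f) \<longlonglongrightarrow> 0"
    by (simp add: L2_dist2_def)
  \<comment> \<open>The chosen indices need not increase with \<open>k\<close>; only the rate
    matters.\<close>
  have "\<exists>i. L2_dist2 (w i) f \<le> ennreal ((1 / 4) ^ k)" for k
    using order_tendstoD(2)[OF lim, of "ennreal ((1 / 4) ^ k)"]
    by (auto simp: eventually_sequentially intro: less_imp_le)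
  then obtain r where "\<And>k. L2_dist2 (w (r k)) f \<le> ennreal ((1 / 4) ^ k)"
    by metis
  with w1 w2 show ?thesis
    by (intro that[of "\<lambda>k. w (r k)"])
qed

section \<open>Extension from \<open>L\<^sup>1 \<inter> L\<^sup>2\<close> to \<open>L\<^sup>2\<close>\<close>

lemma L2_limit_L2: "L2_limit S f g \<Longrightarrow> L2_scalar g"
  by (simp add: L2_limit_def)

text \<open>What the Fourier integral and its inverse have in common, so that the extension theory
  is developed once. \<open>S_le\<close> is meaningful for every integrable \<open>u\<close>, since
  either side may be infinite.\<close>

locale L2_contraction =
  fixes S :: "(real ^ 'n \<Rightarrow> complex) \<Rightarrow> real ^ 'n \<Rightarrow> complex"
  assumes S_measurable: "integrable lborel u \<Longrightarrow> S u \<in> borel_measurable borel"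
    and S_le: "integrable lborel u \<Longrightarrow> L2_dist2 (S u) (\<lambda>_. 0) \<le> L2_dist2 u (\<lambda>_. 0)"
    and S_add: "integrable lborel u \<Longrightarrow> integrable lborel v \<Longrightarrow> S (\<lambda>x. u x + v x) = (\<lambda>y. S u y + S v y)"
    and S_cmult: "integrable lborel u \<Longrightarrow> S (\<lambda>x. a * u x) = (\<lambda>y. a * S u y)"
begin

lemma S_L2: "integrable lborel u \<Longrightarrow> L2_scalar u \<Longrightarrow> L2_scalar (S u)"
  using S_measurable[of u] S_le[of u] by (auto simp: L2_scalar_iff)

lemma S_dist:
  assumes "integrable lborel u" "integrable lborel v"
  shows "L2_dist2 (S u) (S v) \<le> L2_dist2 u v"
proof -
  have "S (\<lambda>x. u x + - 1 * v x) = (\<lambda>y. S u y + - 1 * S v y)"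
    using assms by (subst S_add) (simp_all only: S_cmult integrable_mult_right)
  then show ?thesis
    using S_le[of "\<lambda>x. u x + - 1 * v x"] assms by (simp add: L2_dist2_def)
qed

text \<open>\<open>S_dist\<close> transfers the Cauchy rate of the approximants to their images, and
  completeness supplies the limit.\<close>

lemma L2_limit_exists:
  assumes f: "L2_scalar f" shows "\<exists>g. L2_limit S f g"
proof -
  obtain u where u: "\<And>k. integrable lborel (u k)" "\<And>k. L2_scalar (u k)"
    and uf: "\<And>k::nat. L2_dist2 (u k) f \<le> ennreal ((1 / 4) ^ k)"
    using L2_L1_approx[OF f] by blast
  have [measurable]: "u k \<in> borel_measurable borel" "f \<in> borel_measurable borel" for k
    using u(2) f by (simp_all add: L2_scalar_iff)
  have "L2_dist2 (S (u i)) (S (u j)) \<le> ennreal (2 * ((1 / 4) ^ i + (1 / 4) ^ j))" for i j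
  proof -
    have "L2_dist2 (S (u i)) (S (u j)) \<le> L2_dist2 (u i) (u j)"
      by (intro S_dist u)
    also have "\<dots> \<le> 2 * L2_dist2 (u i) f + 2 * L2_dist2 f (u j)"
      by (intro L2_dist2_triangle) simp_all
    also have "L2_dist2 f (u j) = L2_dist2 (u j) f"
      by (rule L2_dist2_commute)
    also have "2 * L2_dist2 (u i) f + 2 * L2_dist2 (u j) f \<le> 2 * ennreal ((1 / 4) ^ i) + 2 * ennreal ((1 / 4) ^ j)"
      by (intro add_mono mult_left_mono uf) auto
    also have "\<dots> = ennreal (2 * ((1 / 4) ^ i + (1 / 4) ^ j))"
      by (simp add: ennreal_mult distrib_left)
    finally show ?thesis .
  qed
  then obtain g where g: "L2_scalar g" "(\<lambda>k. L2_dist2 (S (u k)) g) \<longlonglongrightarrow> 0"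
    using L2_complete[of "\<lambda>k. S (u k)"] S_L2 u by metis
  have "(\<lambda>k. ennreal ((1 / 4) ^ k)) \<longlonglongrightarrow> ennreal 0"
    by (intro tendsto_ennrealI LIMSEQ_power_zero) simp
  then have "(\<lambda>k. L2_dist2 (u k) f) \<longlonglongrightarrow> 0"
    by (intro tendsto_0_le_ennreal[OF _ uf]) simp
  with g u show ?thesis
    unfolding L2_limit_def L2_dist2_def by blast
qed

text \<open>This concerns every limit \<open>g\<close>, not only the selected one, and so yields
  uniqueness as well as boundedness. The factor 4 comes from two uses of the triangle inequality
  with factors 2.\<close>

lemma L2_limit_le:
  assumes f: "L2_scalar f" and g: "L2_limit S f g"
  shows "L2_dist2 g (\<lambda>_. 0) \<le> 4 * L2_dist2 f (\<lambda>_. 0)"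
proof -
  obtain u where u: "\<And>k. integrable lborel (u k)" "\<And>k. L2_scalar (u k)"
    and uf: "(\<lambda>k. L2_dist2 (u k) f) \<longlonglongrightarrow> 0" and ug: "(\<lambda>k. L2_dist2 (S (u k)) g) \<longlonglongrightarrow> 0"
    using g unfolding L2_limit_def L2_dist2_def by blast
  have [measurable]: "u k \<in> borel_measurable borel" "f \<in> borel_measurable borel" "g \<in> borel_measurable borel"
      "S (u k) \<in> borel_measurable borel" for k
    using u(2)[of k] f L2_limit_L2[OF g] S_measurable[OF u(1)[of k]] by (simp_all add: L2_scalar_iff)
  have "L2_dist2 g (\<lambda>_. 0) \<le> 2 * L2_dist2 (S (u k)) g + 2 * (2 * L2_dist2 (u k) f + 2 * L2_dist2 f (\<lambda>_. 0))" for k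
  proof -
    have "L2_dist2 g (\<lambda>_. 0) \<le> 2 * L2_dist2 g (S (u k)) + 2 * L2_dist2 (S (u k)) (\<lambda>_. 0)"
      by (intro L2_dist2_triangle) simp_all
    also have "\<dots> \<le> 2 * L2_dist2 g (S (u k)) + 2 * (2 * L2_dist2 (u k) f + 2 * L2_dist2 f (\<lambda>_. 0))"
      by (intro add_left_mono mult_left_mono order_trans[OF S_le L2_dist2_triangle] u) simp_all
    finally show ?thesis
      by (simp add: L2_dist2_commute[of g])
  qed
  moreover have "(\<lambda>k. 2 * L2_dist2 (S (u k)) g + 2 * (2 * L2_dist2 (u k) f + 2 * L2_dist2 f (\<lambda>_. 0)))
      \<longlonglongrightarrow> 2 * 0 + 2 * (2 * 0 + 2 * L2_dist2 f (\<lambda>_. 0))"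
    by (intro tendsto_add tendsto_const ennreal_tendsto_cmult uf ug) simp_all
  ultimately have "L2_dist2 g (\<lambda>_. 0) \<le> 2 * 0 + 2 * (2 * 0 + 2 * L2_dist2 f (\<lambda>_. 0))"
    by (intro LIMSEQ_le_const) auto
  then show ?thesis
    by (simp add: mult.assoc[symmetric])
qed

text \<open>The shape \<open>f + a * f'\<close> covers sums (\<open>a = 1\<close>), differences
  (\<open>a = -1\<close>) and, with \<open>f' = f\<close>, scalar multiples.\<close>

lemma L2_limit_lincomb:
  assumes f: "L2_scalar f" "L2_limit S f g" and f': "L2_scalar f'" "L2_limit S f' g'"
  shows "L2_limit S (\<lambda>x. f x + a * f' x) (\<lambda>x. g x + a * g' x)"
proof -
  obtain u where u: "\<And>k. integrable lborel (u k)" "\<And>k. L2_scalar (u k)"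
    and uf: "(\<lambda>k. L2_dist2 (u k) f) \<longlonglongrightarrow> 0" and ug: "(\<lambda>k. L2_dist2 (S (u k)) g) \<longlonglongrightarrow> 0"
    using f(2) unfolding L2_limit_def L2_dist2_def by blast
  obtain u' where u': "\<And>k. integrable lborel (u' k)" "\<And>k. L2_scalar (u' k)"
    and uf': "(\<lambda>k. L2_dist2 (u' k) f') \<longlonglongrightarrow> 0" and ug': "(\<lambda>k. L2_dist2 (S (u' k)) g') \<longlonglongrightarrow> 0"
    using f'(2) unfolding L2_limit_def L2_dist2_def by blast
  have [measurable]: "f \<in> borel_measurable borel" "f' \<in> borel_measurable borel"
      "g \<in> borel_measurable borel" "g' \<in> borel_measurable borel"
      "u k \<in> borel_measurable borel" "u' k \<in> borel_measurable borel"
      "S (u k) \<in> borel_measurable borel" "S (u' k) \<in> borel_measurable borel" for k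
    using u(2)[of k] u'(2)[of k] f(1) f'(1) L2_limit_L2[OF f(2)] L2_limit_L2[OF f'(2)]
      S_measurable[OF u(1)[of k]] S_measurable[OF u'(1)[of k]] by (simp_all add: L2_scalar_iff)
  have sq: "(\<lambda>k. L2_dist2 (\<lambda>x. p k x + a * p' k x) (\<lambda>x. q x + a * q' x)) \<longlonglongrightarrow> 0"
    if [measurable]: "\<And>k::nat. p k \<in> borel_measurable borel" "\<And>k. p' k \<in> borel_measurable borel"
        "q \<in> borel_measurable borel" "q' \<in> borel_measurable borel"
      and lim: "(\<lambda>k. L2_dist2 (p k) q) \<longlonglongrightarrow> 0" "(\<lambda>k. L2_dist2 (p' k) q') \<longlonglongrightarrow> 0" for p p' q q'
  proof (rule tendsto_0_le_ennreal)
    have "(\<lambda>k. 2 * L2_dist2 (p k) q + 2 * (ennreal ((cmod a)\<^sup>2) * L2_dist2 (p' k) q')) \<longlonglongrightarrow>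
        2 * 0 + 2 * (ennreal ((cmod a)\<^sup>2) * 0)"
      by (intro tendsto_add ennreal_tendsto_cmult lim) simp_all
    then show "(\<lambda>k. 2 * L2_dist2 (p k) q + 2 * (ennreal ((cmod a)\<^sup>2) * L2_dist2 (p' k) q')) \<longlonglongrightarrow> 0"
      by simp
    fix k
    \<comment> \<open>The intermediate function \<open>q + a * p' k\<close> changes one summand at a
      time.\<close>
    have "L2_dist2 (\<lambda>x. p k x + a * p' k x) (\<lambda>x. q x + a * q' x) \<le>
        2 * L2_dist2 (\<lambda>x. p k x + a * p' k x) (\<lambda>x. q x + a * p' k x) +
        2 * L2_dist2 (\<lambda>x. q x + a * p' k x) (\<lambda>x. q x + a * q' x)"
      by (intro L2_dist2_triangle) measurable
    also have "L2_dist2 (\<lambda>x. p k x + a * p' k x) (\<lambda>x. q x + a * p' k x) = L2_dist2 (p k) q"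
      by (simp add: L2_dist2_def)
    also have "L2_dist2 (\<lambda>x. q x + a * p' k x) (\<lambda>x. q x + a * q' x) = ennreal ((cmod a)\<^sup>2) * L2_dist2 (p' k) q'"
      by (subst L2_dist2_mult[symmetric]) (simp_all add: L2_dist2_def)
    finally show "L2_dist2 (\<lambda>x. p k x + a * p' k x) (\<lambda>x. q x + a * q' x) \<le>
        2 * L2_dist2 (p k) q + 2 * (ennreal ((cmod a)\<^sup>2) * L2_dist2 (p' k) q')" .
  qed
  let ?u = "\<lambda>k x. u k x + a * u' k x"
  have "S (?u k) = (\<lambda>y. S (u k) y + a * S (u' k) y)" for k
    using u u' by (simp add: S_add S_cmult)
  then have "(\<lambda>k. L2_dist2 (S (?u k)) (\<lambda>x. g x + a * g' x)) \<longlonglongrightarrow> 0"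
    using sq[of "\<lambda>k. S (u k)" "\<lambda>k. S (u' k)" g g'] ug ug' by simp
  moreover have "(\<lambda>k. L2_dist2 (?u k) (\<lambda>x. f x + a * f' x)) \<longlonglongrightarrow> 0"
    using sq[of u u' f f'] uf uf' by simp
  moreover have "L2_scalar (\<lambda>x. g x + a * g' x)" "integrable lborel (?u k)" "L2_scalar (?u k)" for k
    using u u' L2_limit_L2[OF f(2)] L2_limit_L2[OF f'(2)] by (auto intro!: L2_scalar_add L2_scalar_cmult)
  ultimately show ?thesis
    unfolding L2_limit_def L2_dist2_def by (intro conjI exI[of _ ?u]) auto
qed

text \<open>The difference of the outputs is a limit for the difference of the inputs, which is
  null, so \<open>L2_limit_le\<close> makes it null too. Inputs that agree only almost everywhere
  are allowed because the choice in \<open>L2_extension\<close> may depend on the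
  representative.\<close>

lemma L2_limit_unique_AE:
  assumes f: "L2_scalar f" "L2_limit S f g" and f': "L2_scalar f'" "L2_limit S f' g'"
    and eq: "AE x in lborel. f x = f' x"
  shows "AE x in lborel. g x = g' x"
proof -
  have [measurable]: "f \<in> borel_measurable borel" "f' \<in> borel_measurable borel"
      "g \<in> borel_measurable borel" "g' \<in> borel_measurable borel"
    using f(1) f'(1) L2_limit_L2[OF f(2)] L2_limit_L2[OF f'(2)] by (simp_all add: L2_scalar_iff)
  have lim: "L2_limit S (\<lambda>x. f x + - 1 * f' x) (\<lambda>x. g x + - 1 * g' x)"
    by (intro L2_limit_lincomb f f')
  have "L2_scalar (\<lambda>x. f x + - 1 * f' x)"
    by (intro L2_scalar_add L2_scalar_cmult f f')
  then have "L2_dist2 (\<lambda>x. g x + - 1 * g' x) (\<lambda>_. 0) \<le> 4 * L2_dist2 (\<lambda>x. f x + - 1 * f' x) (\<lambda>_. 0)"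
    by (intro L2_limit_le lim)
  also have "L2_dist2 (\<lambda>x. f x + - 1 * f' x) (\<lambda>_. 0) = 0"
    using eq by (subst L2_dist2_eq_0_iff) auto
  finally have "L2_dist2 (\<lambda>x. g x + - 1 * g' x) (\<lambda>_. 0) = 0"
    by simp
  then show ?thesis
    by (subst (asm) L2_dist2_eq_0_iff) auto
qed

lemma L2_limit_extension: "L2_scalar f \<Longrightarrow> L2_limit S f (L2_extension S f)"
  unfolding L2_extension_def by (rule someI_ex[OF L2_limit_exists])

lemma L2_extension_L2: "L2_scalar f \<Longrightarrow> L2_scalar (L2_extension S f)"
  by (rule L2_limit_L2[OF L2_limit_extension])

lemma L2_extension_le:
  "L2_scalar f \<Longrightarrow> L2_dist2 (L2_extension S f) (\<lambda>_. 0) \<le> 4 * L2_dist2 f (\<lambda>_. 0)"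
  by (intro L2_limit_le L2_limit_extension)

lemma L2_extension_lincomb:
  assumes "L2_scalar f" "L2_scalar g" "L2_scalar h" "AE x in lborel. h x = f x + a * g x"
  shows "AE y in lborel. L2_extension S h y = L2_extension S f y + a * L2_extension S g y"
  by (rule L2_limit_unique_AE[OF assms(3) L2_limit_extension[OF assms(3)] _ _ assms(4)])
     (intro L2_limit_lincomb L2_limit_extension L2_scalar_add L2_scalar_cmult assms)+

text \<open>The way to evaluate the choice operator: the constant sequence \<open>u\<close> exhibits
  \<open>S u\<close> as one limit, and limits are unique up to null sets.\<close>

lemma L2_extension_eq:
  assumes f: "L2_scalar f" and u: "integrable lborel u" "L2_scalar u" and eq: "AE x in lborel. f x = u x"
  shows "AE y in lborel. L2_extension S f y = S u y"
proof -
  have "L2_limit S u (S u)"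
    unfolding L2_limit_def using u S_L2[OF u] by (auto intro!: exI[of _ "\<lambda>_. u"])
  then show ?thesis
    by (rule L2_limit_unique_AE[OF f L2_limit_extension[OF f] u(2) _ eq])
qed

end

interpretation fourier: L2_contraction "fourier_int :: (real ^ 'n \<Rightarrow> complex) \<Rightarrow> real ^ 'n \<Rightarrow> complex"
proof
  fix u v :: "real ^ 'n \<Rightarrow> complex" and a :: complex
  assume u: "integrable lborel u"
  show "fourier_int u \<in> borel_measurable borel"
    using borel_measurable_integrable[OF u] by simp
  show "L2_dist2 (fourier_int u) (\<lambda>_. 0) \<le> L2_dist2 u (\<lambda>_. 0)"
    using fourier_int_L2_le[OF u] by (simp add: L2_dist2_def)
  show "fourier_int (\<lambda>x. a * u x) = (\<lambda>y. a * fourier_int u y)"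
  proof -
    have eq: "exp (- \<i> * complex_of_real (y \<bullet> x)) * (a * u x) = a * (exp (- \<i> * complex_of_real (y \<bullet> x)) * u x)" for x y
      by (rule mult.left_commute)
    show ?thesis
      unfolding fourier_int_def eq integral_mult_right_zero by (simp only: mult.left_commute[of a])
  qed
  assume v: "integrable lborel v"
  show "fourier_int (\<lambda>x. u x + v x) = (\<lambda>y. fourier_int u y + fourier_int v y)"
    using integrable_iexp_mult(2)[OF u] integrable_iexp_mult(2)[OF v]
    by (simp add: fourier_int_def distrib_left fun_eq_iff)
qed

interpretation inv_fourier: L2_contraction "inv_fourier_int :: (real ^ 'n \<Rightarrow> complex) \<Rightarrow> real ^ 'n \<Rightarrow> complex"
proof
  fix u v :: "real ^ 'n \<Rightarrow> complex" and a :: complex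
  assume u: "integrable lborel u"
  have [measurable]: "fourier_int u \<in> borel_measurable borel"
    by (rule fourier.S_measurable[OF u])
  show "inv_fourier_int u \<in> borel_measurable borel"
    unfolding inv_fourier_int_eq by measurable
  show "L2_dist2 (inv_fourier_int u) (\<lambda>_. 0) \<le> L2_dist2 u (\<lambda>_. 0)"
    using inv_fourier_int_L2_le[OF u] by (simp add: L2_dist2_def)
  show "inv_fourier_int (\<lambda>x. a * u x) = (\<lambda>y. a * inv_fourier_int u y)"
    by (simp add: inv_fourier_int_eq fourier.S_cmult[OF u])
  assume v: "integrable lborel v"
  show "inv_fourier_int (\<lambda>x. u x + v x) = (\<lambda>y. inv_fourier_int u y + inv_fourier_int v y)"
    by (simp add: inv_fourier_int_eq fourier.S_add[OF u v])
qed

section \<open>Injectivity of the inverse transform at the origin\<close>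

lemma fourier_int_gauss:
  "fourier_int (\<lambda>x. complex_of_real (gauss 1 x)) = (\<lambda>y::real ^ 'n. complex_of_real (gauss 1 y))"
proof
  fix y :: "real ^ 'n"
  show "fourier_int (\<lambda>x. complex_of_real (gauss 1 x)) y = complex_of_real (gauss 1 y)"
    \<comment> \<open>The minus sign matches the kernel \<open>exp (- i y x)\<close>. At width 1 the
      prefactor of the transform is also the normalisation of the density, so the Gaussian is
      reproduced exactly.\<close>
    using integral_iexp_gauss[of 1 "- y"] by (simp add: fourier_int_def gauss_eq)
qed

text \<open>Fubini moves the transform from \<open>g\<close> onto a Gaussian of the reciprocal width
  \<open>1 / r\<close>, whose transform is a multiple of \<open>gauss r\<close>.\<close>

lemma integral_gauss_eq_0:
  fixes g :: "real ^ 'n \<Rightarrow> complex"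
  assumes g: "integrable lborel g" and zero: "AE x in lborel. inv_fourier_int g x = 0" and r: "0 < r"
  shows "(\<integral>y. g y * complex_of_real (gauss r y) \<partial>lborel) = 0"
proof -
  define s where "s = 1 / r"
  have s: "0 < s"
    using r by (simp add: s_def)
  note [measurable] = borel_measurable_integrable[OF g]
  define H where "H x y = complex_of_real (gauss s x) * (exp (\<i> * complex_of_real (x \<bullet> y)) * g y)" for x y
  have "integrable (lborel \<Otimes>\<^sub>M lborel) (\<lambda>p. complex_of_real (gauss s (fst p)) * g (snd p))"
    using s g by (intro lborel_pair.integrable_mult_pair) auto
  moreover have "case_prod H \<in> borel_measurable (lborel \<Otimes>\<^sub>M lborel)"
    unfolding H_def by measurable
  ultimately have int_H: "integrable (lborel \<Otimes>\<^sub>M lborel) (case_prod H)"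
    by (rule Bochner_Integration.integrable_bound) (auto simp: H_def norm_mult)
  have "(\<integral>x. H x y \<partial>lborel) = g y * complex_of_real (exp (- (s * norm y)\<^sup>2 / 2))" for y
  proof -
    have "H x y = g y * (exp (\<i> * complex_of_real (y \<bullet> x)) * complex_of_real (gauss s x))" for x
      by (simp add: H_def inner_commute ac_simps)
    then show ?thesis
      by (simp only: integral_mult_right_zero integral_iexp_gauss[OF s])
  qed
  moreover have "AE x in lborel. (\<integral>y. H x y \<partial>lborel) = 0"
    using zero
  proof eventually_elim
    case (elim x)
    then have "(\<integral>y. exp (\<i> * complex_of_real (x \<bullet> y)) * g y \<partial>lborel) = 0"
      by (simp add: inv_fourier_int_def)
    then show ?case
      unfolding H_def by (simp only: integral_mult_right_zero mult_zero_right)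
  qed
  then have "(\<integral>x. (\<integral>y. H x y \<partial>lborel) \<partial>lborel) = 0"
    by (rule integral_eq_zero_AE)
  ultimately have *: "(\<integral>y. g y * complex_of_real (exp (- (s * norm y)\<^sup>2 / 2)) \<partial>lborel) = 0"
    using lborel_pair.Fubini_integral[OF int_H] by simp
  have "g y * complex_of_real (gauss r y) =
      complex_of_real ((2 * pi * r\<^sup>2) powr (- real CARD('n) / 2)) *
      (g y * complex_of_real (exp (- (s * norm y)\<^sup>2 / 2)))" for y
    using r by (simp add: gauss_eq s_def power_divide)
  with * show ?thesis
    by (simp only: integral_mult_right_zero mult_zero_right)
qed

text \<open>The substitution \<open>y = r z\<close> moves the parameter from the density into
  \<open>h\<close>, so that as \<open>r\<close> tends to 0 a fixed Gaussian can dominate.\<close>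

lemma integral_gauss_scale:
  fixes h :: "'a::euclidean_space \<Rightarrow> complex"
  assumes r: "0 < r" and [measurable]: "h \<in> borel_measurable borel"
  shows "(\<integral>y. h y * complex_of_real (gauss r y) \<partial>lborel) =
    (\<integral>z. h (r *\<^sub>R z) * complex_of_real (gauss 1 z) \<partial>lborel)"
proof -
  have scale: "r ^ DIM('a) * gauss r (r *\<^sub>R z) = gauss 1 z" for z :: 'a
  proof -
    have "r * normal_density 0 r (r * t) = normal_density 0 1 t" for t
      using r by (simp add: normal_density_def real_sqrt_mult power_mult_distrib)
    moreover have "r ^ DIM('a) * gauss r (r *\<^sub>R z) = (\<Prod>b\<in>Basis. r * normal_density 0 r (r * (z \<bullet> b)))"
      by (simp only: gauss_def prod.distrib prod_constant inner_scaleR_left)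
    ultimately show ?thesis
      by (simp only: gauss_def)
  qed
  have "(\<integral>y. h y * complex_of_real (gauss r y) \<partial>lborel) =
    (\<integral>y. h y * complex_of_real (gauss r y) \<partial>density (distr lborel borel (\<lambda>z::'a. 0 + r *\<^sub>R z)) (\<lambda>_. ennreal (\<bar>r\<bar> ^ DIM('a))))"
    using r by (subst lborel_affine[of r 0]) auto
  also have "\<dots> = (\<integral>z. (r ^ DIM('a)) *\<^sub>R (h (r *\<^sub>R z) * complex_of_real (gauss r (r *\<^sub>R z))) \<partial>lborel)"
    using r by (subst integral_density) (simp_all add: integral_distr)
  also have "\<dots> = (\<integral>z. h (r *\<^sub>R z) * complex_of_real (gauss 1 z) \<partial>lborel)"
    by (intro Bochner_Integration.integral_cong refl) (simp add: scale[symmetric] scaleR_conv_of_real)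
  finally show ?thesis .
qed

lemma gauss_approx_identity:
  fixes h :: "'a::euclidean_space \<Rightarrow> complex"
  assumes h: "continuous_on UNIV h" and C: "\<And>x. cmod (h x) \<le> C"
  shows "(\<lambda>k. \<integral>y. h y * complex_of_real (gauss (inverse (real (Suc k))) y) \<partial>lborel) \<longlonglongrightarrow> h 0"
proof -
  have [measurable]: "h \<in> borel_measurable borel"
    using h by (rule borel_measurable_continuous_onI)
  have "(\<lambda>k. \<integral>z. h (inverse (real (Suc k)) *\<^sub>R z) * complex_of_real (gauss 1 z) \<partial>lborel) \<longlonglongrightarrow>
      (\<integral>z. h 0 * complex_of_real (gauss 1 (z::'a)) \<partial>lborel)"
  proof (rule integral_dominated_convergence)
    show "integrable lborel (\<lambda>z::'a. C * gauss 1 z)"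
      by (intro integrable_mult_right integrable_gauss) simp
    show "AE z in lborel. (\<lambda>k. h (inverse (real (Suc k)) *\<^sub>R z) * complex_of_real (gauss 1 z))
        \<longlonglongrightarrow> h 0 * complex_of_real (gauss 1 z)"
    proof (intro AE_I2 tendsto_mult tendsto_const)
      fix z :: 'a
      have "(\<lambda>k. inverse (real (Suc k)) *\<^sub>R z) \<longlonglongrightarrow> 0 *\<^sub>R z"
        by (intro tendsto_scaleR LIMSEQ_inverse_real_of_nat tendsto_const)
      from continuous_on_tendsto_compose[OF h this]
      show "(\<lambda>k. h (inverse (real (Suc k)) *\<^sub>R z)) \<longlonglongrightarrow> h 0"
        by simp
    qed
    show "AE z in lborel. norm (h (inverse (real (Suc k)) *\<^sub>R z) * complex_of_real (gauss 1 z)) \<le> C * gauss 1 z" for k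
      by (auto simp: norm_mult intro!: mult_right_mono C)
  qed simp_all
  moreover have "(\<integral>z. h 0 * complex_of_real (gauss 1 (z::'a)) \<partial>lborel) = h 0"
    by simp
  moreover have "(\<integral>y. h y * complex_of_real (gauss (inverse (real (Suc k))) y) \<partial>lborel) =
      (\<integral>z. h (inverse (real (Suc k)) *\<^sub>R z) * complex_of_real (gauss 1 z) \<partial>lborel)" for k
    by (rule integral_gauss_scale) simp_all
  ultimately show ?thesis
    by (simp only:)
qed

text \<open>The product with the Gaussian is integrable, bounded and continuous. Its pairings with
  narrow Gaussians vanish and converge to its value at 0, where the Gaussian factor is positive and
  cancels.\<close>

lemma inv_fourier_int_gauss_mult_eq_0:
  fixes h :: "real ^ 'n \<Rightarrow> complex"
  assumes h: "continuous_on UNIV h" and C: "\<And>x. cmod (h x) \<le> C"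
    and zero: "AE x in lborel. inv_fourier_int (\<lambda>y. complex_of_real (gauss 1 y) * h y) x = 0"
  shows "h 0 = 0"
proof -
  let ?g = "\<lambda>y. complex_of_real (gauss 1 y) * h y"
  have [measurable]: "h \<in> borel_measurable borel"
    using h by (rule borel_measurable_continuous_onI)
  have C0: "0 \<le> C"
    using order_trans[OF norm_ge_zero C] .
  define B where "B = (2 * pi) powr (- real CARD('n) / 2)"
  have gauss_eq1: "gauss 1 = (\<lambda>y :: real ^ 'n. B * exp (- (norm y)\<^sup>2 / 2))"
    by (simp add: fun_eq_iff gauss_eq B_def)
  have "integrable lborel ?g"
  proof (rule Bochner_Integration.integrable_bound)
    show "integrable lborel (\<lambda>y :: real ^ 'n. gauss 1 y * C)"
      by simp
    show "AE y in lborel. norm (?g y) \<le> norm (gauss 1 y * C)"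
      using C C0 by (auto simp: norm_mult intro!: mult_left_mono)
  qed simp
  then have "(\<integral>y. ?g y * complex_of_real (gauss (inverse (real (Suc k))) y) \<partial>lborel) = 0" for k
    by (intro integral_gauss_eq_0 zero) simp_all
  moreover have "continuous_on UNIV ?g"
    unfolding gauss_eq1 by (intro continuous_intros h) simp_all
  moreover have "cmod (?g y) \<le> B * C" for y
  proof -
    have "gauss 1 y \<le> B"
      unfolding gauss_eq1 by (simp add: B_def mult_left_le)
    then show ?thesis
      using C C0 by (auto simp: norm_mult B_def intro!: mult_mono)
  qed
  ultimately have "(\<lambda>k::nat. 0) \<longlonglongrightarrow> ?g 0"
    using gauss_approx_identity[of ?g "B * C"] by simp
  then have "?g 0 = 0"
    by (simp add: LIMSEQ_const_iff)
  then show ?thesis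
    using gauss_pos[of 1 "0 :: real ^ 'n"] by simp
qed

section \<open>Fourier multipliers with matrix symbols\<close>

lemma cmod_entry_le_onorm:
  fixes A :: "complex ^ 'm ^ 'm"
  shows "cmod (A $ i $ j) \<le> onorm ((*v) A)"
proof -
  have "A $ i $ j = (A *v axis j 1) $ i"
    by (simp add: matrix_vector_mult_def axis_def if_distrib cong: if_cong)
  also have "cmod \<dots> \<le> norm (A *v axis j 1)"
    by (rule Finite_Cartesian_Product.norm_nth_le)
  also have "\<dots> \<le> onorm ((*v) A) * norm (axis j 1 :: complex ^ 'm)"
    by (rule onorm) simp
  finally show ?thesis
    by simp
qed

lemma onorm_le_sum_entries:
  fixes A :: "complex ^ 'm ^ 'm"
  shows "onorm ((*v) A) \<le> (\<Sum>i\<in>UNIV. \<Sum>j\<in>UNIV. cmod (A $ i $ j))"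
proof (rule onorm_le)
  fix x :: "complex ^ 'm"
  have "norm (A *v x) \<le> (\<Sum>i\<in>UNIV. cmod ((A *v x) $ i))"
    unfolding norm_vec_def by (rule L2_set_le_sum) simp
  also have "\<dots> \<le> (\<Sum>i\<in>UNIV. \<Sum>j\<in>UNIV. cmod (A $ i $ j) * norm x)"
    unfolding matrix_vector_mult_def
    by (auto intro!: sum_mono order_trans[OF norm_sum] mult_left_mono
        simp: norm_mult Finite_Cartesian_Product.norm_nth_le)
  finally show "norm (A *v x) \<le> (\<Sum>i\<in>UNIV. \<Sum>j\<in>UNIV. cmod (A $ i $ j)) * norm x"
    by (simp add: sum_distrib_right)
qed

lemma onorm_sq_le_sum_entries:
  fixes A :: "complex ^ 'm ^ 'm"
  shows "(onorm ((*v) A))\<^sup>2 \<le> (real CARD('m))\<^sup>2 * (\<Sum>i\<in>UNIV. \<Sum>j\<in>UNIV. (cmod (A $ i $ j))\<^sup>2)"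
proof -
  have "(onorm ((*v) A))\<^sup>2 \<le> (\<Sum>p\<in>UNIV \<times> UNIV. cmod (A $ fst p $ snd p))\<^sup>2"
    using onorm_le_sum_entries[of A]
    by (intro power_mono) (simp_all add: sum.cartesian_product case_prod_unfold onorm_pos_le)
  also have "\<dots> \<le> (\<Sum>p\<in>UNIV \<times> UNIV. (cmod (A $ fst p $ snd p))\<^sup>2) * real (card (UNIV \<times> UNIV :: ('m \<times> 'm) set))"
    by (rule sum_squared_le_sum_of_squares)
  also have "real (card (UNIV \<times> UNIV :: ('m \<times> 'm) set)) = (real CARD('m))\<^sup>2"
    by (simp only: card_cartesian_product power2_eq_square of_nat_mult)
  finally show ?thesis
    by (simp add: sum.cartesian_product case_prod_unfold mult.commute)
qed

text \<open>\<open>onorm\<close> is a supremum over uncountably many vectors, so measurability is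
  obtained from continuity: by the triangle inequality it is Lipschitz in the Frobenius
  norm.\<close>

lemma onorm_matrix_measurable [measurable]:
  "(\<lambda>A :: complex ^ 'm ^ 'm. onorm ((*v) A)) \<in> borel_measurable borel"
proof (rule borel_measurable_continuous_onI)
  let ?N = "\<lambda>A :: complex ^ 'm ^ 'm. onorm ((*v) A)"
  have le: "?N A \<le> ?N B + (real CARD('m))\<^sup>2 * norm (A - B)" for A B
  proof -
    have "?N A = onorm (\<lambda>x. B *v x + (A - B) *v x)"
      by (simp add: matrix_vector_mult_diff_rdistrib)
    also have "\<dots> \<le> ?N B + ?N (A - B)"
      by (intro onorm_triangle) simp_all
    also have "?N (A - B) \<le> (\<Sum>i\<in>(UNIV :: 'm set). \<Sum>j\<in>(UNIV :: 'm set). norm (A - B))"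
      by (intro order_trans[OF onorm_le_sum_entries] sum_mono
          order_trans[OF Finite_Cartesian_Product.norm_nth_le Finite_Cartesian_Product.norm_nth_le])
    finally show ?thesis
      by (simp add: power2_eq_square mult.assoc)
  qed
  have "((real CARD('m))\<^sup>2)-lipschitz_on UNIV ?N"
  proof (rule lipschitz_onI)
    fix A B :: "complex ^ 'm ^ 'm"
    show "dist (?N A) (?N B) \<le> (real CARD('m))\<^sup>2 * dist A B"
      using le[of A B] le[of B A] by (simp add: dist_norm norm_minus_commute abs_le_iff)
  qed simp
  then show "continuous_on UNIV ?N"
    by (rule lipschitz_on_continuous_on)
qed

lemma matrix_entry_measurable [measurable]:
  "(\<lambda>A :: complex ^ 'm ^ 'm. A $ i $ j) \<in> borel_measurable borel"
  by (intro borel_measurable_continuous_onI continuous_intros)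

lemma borel_measurable_matrix:
  fixes f :: "'a \<Rightarrow> complex ^ 'm ^ 'm"
  assumes "\<And>i j. (\<lambda>x. f x $ i $ j) \<in> borel_measurable M"
  shows "f \<in> borel_measurable M"
  by (subst borel_measurable_euclidean_space)
     (auto simp: Basis_vec_def inner_axis intro!: borel_measurable_inner assms)

definition L2_matrix_sq :: "(real ^ 'n \<Rightarrow> complex ^ 'm ^ 'm) \<Rightarrow> ennreal" where
  "L2_matrix_sq f = (\<integral>\<^sup>+x. ennreal ((onorm ((*v) (f x)))\<^sup>2) \<partial>lborel)"

lemma L2_matrix_iff_sq: "L2_matrix f \<longleftrightarrow> f \<in> borel_measurable borel \<and> L2_matrix_sq f < \<infinity>"
  by (auto simp: L2_matrix_def L2_matrix_sq_def integrable_iff_bounded)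

lemma L2_dist2_entry_le: "L2_dist2 (\<lambda>x. f x $ i $ j) (\<lambda>_. 0) \<le> L2_matrix_sq f"
  unfolding L2_dist2_def L2_matrix_sq_def
  by (intro nn_integral_mono ennreal_leI power_mono) (simp_all add: cmod_entry_le_onorm)

lemma L2_matrix_sq_le:
  fixes f :: "real ^ 'n \<Rightarrow> complex ^ 'm ^ 'm"
  assumes [measurable]: "f \<in> borel_measurable borel"
  shows "L2_matrix_sq f \<le> ennreal ((real CARD('m))\<^sup>2) * (\<Sum>i\<in>UNIV. \<Sum>j\<in>UNIV. L2_dist2 (\<lambda>x. f x $ i $ j) (\<lambda>_. 0))"
proof -
  have "L2_matrix_sq f \<le> (\<integral>\<^sup>+x. ennreal ((real CARD('m))\<^sup>2) *
      (\<Sum>i\<in>UNIV. \<Sum>j\<in>UNIV. ennreal ((cmod (f x $ i $ j))\<^sup>2)) \<partial>lborel)"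
    unfolding L2_matrix_sq_def
    using onorm_sq_le_sum_entries
    by (intro nn_integral_mono) (simp add: sum_nonneg flip: ennreal_mult)
  also have "\<dots> = ennreal ((real CARD('m))\<^sup>2) * (\<Sum>i\<in>UNIV. \<Sum>j\<in>UNIV. L2_dist2 (\<lambda>x. f x $ i $ j) (\<lambda>_. 0))"
    by (subst nn_integral_cmult) (simp_all add: nn_integral_sum L2_dist2_def del: sum_ennreal)
  finally show ?thesis .
qed

text \<open>Norms on matrices of a fixed size are equivalent; this reduces matrix-valued statements
  to the scalar theory.\<close>

lemma L2_matrix_iff: "L2_matrix f \<longleftrightarrow> (\<forall>i j. L2_scalar (\<lambda>x. f x $ i $ j))"
proof
  assume f: "L2_matrix f"
  then have [measurable]: "f \<in> borel_measurable borel"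
    by (simp add: L2_matrix_iff_sq)
  show "\<forall>i j. L2_scalar (\<lambda>x. f x $ i $ j)"
    using f order_le_less_trans[OF L2_dist2_entry_le] by (auto simp: L2_scalar_iff L2_matrix_iff_sq)
next
  assume f: "\<forall>i j. L2_scalar (\<lambda>x. f x $ i $ j)"
  then have meas: "f \<in> borel_measurable borel"
    by (intro borel_measurable_matrix) (simp add: L2_scalar_iff)
  have "L2_matrix_sq f < \<infinity>"
    using f by (intro order_le_less_trans[OF L2_matrix_sq_le[OF meas]])
      (simp add: L2_scalar_iff ennreal_mult_less_top)
  with meas show "L2_matrix f"
    by (simp add: L2_matrix_iff_sq)
qed

lemma L2_matrix_norm_eq: "L2_matrix_norm f = sqrt (enn2real (L2_matrix_sq f))"
  if [measurable]: "f \<in> borel_measurable borel"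
  unfolding L2_matrix_norm_def L2_matrix_sq_def by (subst integral_eq_nn_integral) auto

section \<open>Linearity and boundedness of the multiplier operator\<close>

lemma L2_dist2_sum_le:
  assumes "\<And>l. f l \<in> borel_measurable borel"
  shows "L2_dist2 (\<lambda>x. \<Sum>l\<in>(UNIV :: 'm::finite set). f l x) (\<lambda>_. 0) \<le>
    ennreal (real CARD('m)) * (\<Sum>l\<in>UNIV. L2_dist2 (f l) (\<lambda>_. 0))"
proof -
  note [measurable] = assms
  have "(cmod (\<Sum>l\<in>UNIV. f l x))\<^sup>2 \<le> real CARD('m) * (\<Sum>l\<in>UNIV. (cmod (f l x))\<^sup>2)" for x
  proof -
    have "(cmod (\<Sum>l\<in>UNIV. f l x))\<^sup>2 \<le> (\<Sum>l\<in>UNIV. cmod (f l x))\<^sup>2"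
      by (intro power_mono norm_sum) simp
    also have "\<dots> \<le> (\<Sum>l\<in>UNIV. (cmod (f l x))\<^sup>2) * real CARD('m)"
      by (rule sum_squared_le_sum_of_squares)
    finally show ?thesis
      by (simp add: mult.commute)
  qed
  then have "L2_dist2 (\<lambda>x. \<Sum>l\<in>UNIV. f l x) (\<lambda>_. 0) \<le>
      (\<integral>\<^sup>+x. ennreal (real CARD('m)) * (\<Sum>l\<in>UNIV. ennreal ((cmod (f l x))\<^sup>2)) \<partial>lborel)"
    unfolding L2_dist2_def
    by (intro nn_integral_mono) (simp add: sum_nonneg flip: ennreal_mult)
  also have "\<dots> = ennreal (real CARD('m)) * (\<Sum>l\<in>UNIV. L2_dist2 (f l) (\<lambda>_. 0))"
    by (subst nn_integral_cmult) (simp_all add: nn_integral_sum L2_dist2_def del: sum_ennreal)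
  finally show ?thesis .
qed

text \<open>Not the symbol \<open>G\<close> itself but the entry \<open>(j, k)\<close> of the
  transform of \<open>f\<close> times \<open>G\<close>, to which the scalar inverse transform is
  applied. Only row \<open>j\<close> of \<open>f\<close> enters.\<close>

definition multiplier_symbol ::
  "(real ^ 'n \<Rightarrow> complex ^ 'm ^ 'm) \<Rightarrow> (real ^ 'n \<Rightarrow> complex ^ 'm ^ 'm) \<Rightarrow> 'm \<Rightarrow> 'm \<Rightarrow> real ^ 'n \<Rightarrow> complex" where
  "multiplier_symbol G f j k y =
     (\<Sum>l\<in>UNIV. L2_extension fourier_int (\<lambda>x. f x $ j $ l) y * G y $ l $ k)"

lemma fourier_multiplier_nth:
  "fourier_multiplier G f x $ j $ k = L2_extension inv_fourier_int (multiplier_symbol G f j k) x"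
  by (simp add: fourier_multiplier_def inv_fourier_matrix_def fourier_matrix_def
      matrix_matrix_mult_def multiplier_symbol_def[abs_def])

lemma AE_matrix_eqI:
  fixes f g :: "'a \<Rightarrow> complex ^ 'm ^ 'm"
  assumes "\<And>j k. AE x in M. f x $ j $ k = g x $ j $ k"
  shows "AE x in M. f x = g x"
proof -
  have "AE x in M. \<forall>j\<in>UNIV. \<forall>k\<in>UNIV. f x $ j $ k = g x $ j $ k"
    by (intro AE_finite_allI assms) simp_all
  then show ?thesis
    by (simp add: vec_eq_iff)
qed

text \<open>The bound is entrywise, the form in which a bound on real parts of exponents delivers
  it. Continuity gives measurability and lets the value at the origin be recovered from
  integrals.\<close>

locale bounded_symbol =
  fixes G :: "real ^ 'n \<Rightarrow> complex ^ 'm ^ 'm" and C :: real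
  assumes G_cont: "continuous_on UNIV G" and G_le: "cmod (G y $ j $ k) \<le> C"
begin

lemma entry_continuous: "continuous_on UNIV (\<lambda>y. G y $ j $ k)"
  by (intro continuous_intros G_cont)

lemma entry_measurable [measurable]: "(\<lambda>y. G y $ j $ k) \<in> borel_measurable borel"
  by (intro borel_measurable_continuous_onI entry_continuous)

lemma multiplier_symbol_L2:
  assumes f: "L2_matrix f" shows "L2_scalar (multiplier_symbol G f j k)"
  unfolding multiplier_symbol_def using f
  by (intro L2_scalar_sum L2_scalar_mult_bounded(1)[where C=C] fourier.L2_extension_L2 G_le entry_measurable)
     (simp add: L2_matrix_iff)

text \<open>One factor \<open>CARD('m)\<close> is Cauchy-Schwarz for the sum over \<open>l\<close>,
  the other counts its terms; \<open>C^2\<close> bounds the symbol and 4 comes from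
  \<open>L2_extension_le\<close>.\<close>

lemma multiplier_symbol_le:
  assumes f: "L2_matrix f"
  shows "L2_dist2 (multiplier_symbol G f j k) (\<lambda>_. 0) \<le> ennreal ((real CARD('m))\<^sup>2 * C\<^sup>2 * 4) * L2_matrix_sq f"
proof -
  let ?E = "\<lambda>l. L2_extension fourier_int (\<lambda>x. f x $ j $ l)"
  have fL2: "L2_scalar (\<lambda>x. f x $ j $ l)" for l
    using f by (simp add: L2_matrix_iff)
  have EL2: "L2_scalar (?E l)" for l
    by (intro fourier.L2_extension_L2 fL2)
  have [measurable]: "?E l \<in> borel_measurable borel" for l
    using EL2[of l] by (simp add: L2_scalar_iff)
  have "L2_dist2 (multiplier_symbol G f j k) (\<lambda>_. 0) \<le>
      ennreal (real CARD('m)) * (\<Sum>l\<in>UNIV. L2_dist2 (\<lambda>y. ?E l y * G y $ l $ k) (\<lambda>_. 0))"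
    unfolding multiplier_symbol_def by (rule L2_dist2_sum_le) measurable
  also have "\<dots> \<le> ennreal (real CARD('m)) * (\<Sum>l\<in>(UNIV::'m set). ennreal (C\<^sup>2) * (4 * L2_matrix_sq f))"
  proof (intro mult_left_mono sum_mono)
    fix l
    have "L2_dist2 (\<lambda>y. ?E l y * G y $ l $ k) (\<lambda>_. 0) \<le> ennreal (C\<^sup>2) * L2_dist2 (?E l) (\<lambda>_. 0)"
      by (intro L2_scalar_mult_bounded(2) EL2 G_le entry_measurable)
    also have "\<dots> \<le> ennreal (C\<^sup>2) * (4 * L2_matrix_sq f)"
      by (intro mult_left_mono order_trans[OF fourier.L2_extension_le[OF fL2]] L2_dist2_entry_le) simp_all
    finally show "L2_dist2 (\<lambda>y. ?E l y * G y $ l $ k) (\<lambda>_. 0) \<le> ennreal (C\<^sup>2) * (4 * L2_matrix_sq f)" .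
  qed simp
  also have "\<dots> = ennreal ((real CARD('m))\<^sup>2 * C\<^sup>2 * 4) * L2_matrix_sq f"
  proof -
    have "(real CARD('m))\<^sup>2 * C\<^sup>2 * 4 = real CARD('m) * (real CARD('m) * (C\<^sup>2 * 4))"
      by (simp add: power2_eq_square)
    then have "ennreal ((real CARD('m))\<^sup>2 * C\<^sup>2 * 4) =
        ennreal (real CARD('m)) * (ennreal (real CARD('m)) * (ennreal (C\<^sup>2) * ennreal 4))"
      by (simp only: ennreal_mult[symmetric] zero_le_power2 of_nat_0_le_iff mult_nonneg_nonneg zero_le_numeral)
    then show ?thesis
      by (simp only: sum_constant ennreal_of_nat_eq_real_of_nat ennreal_numeral mult.assoc)
  qed
  finally show ?thesis .
qed

lemma fourier_multiplier_L2:
  assumes "L2_matrix f" shows "L2_matrix (fourier_multiplier G f)"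
  unfolding L2_matrix_iff fourier_multiplier_nth
  by (intro allI inv_fourier.L2_extension_L2 multiplier_symbol_L2 assms)

text \<open>The sixth power collects three squares: from \<open>L2_matrix_sq_le\<close>, from the
  number of entries, and from \<open>multiplier_symbol_le\<close>. The 16 is one factor 4 for each
  of the two transforms.\<close>

lemma fourier_multiplier_sq_le:
  assumes f: "L2_matrix f"
  shows "L2_matrix_sq (fourier_multiplier G f) \<le> ennreal ((real CARD('m)) ^ 6 * C\<^sup>2 * 16) * L2_matrix_sq f"
proof -
  have meas: "fourier_multiplier G f \<in> borel_measurable borel"
    using fourier_multiplier_L2[OF f] by (simp add: L2_matrix_iff_sq)
  have "L2_dist2 (\<lambda>x. fourier_multiplier G f x $ j $ k) (\<lambda>_. 0) \<le>
      4 * (ennreal ((real CARD('m))\<^sup>2 * C\<^sup>2 * 4) * L2_matrix_sq f)" for j k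
    unfolding fourier_multiplier_nth
    by (intro order_trans[OF inv_fourier.L2_extension_le] mult_left_mono multiplier_symbol_le multiplier_symbol_L2 f) simp
  then have "L2_matrix_sq (fourier_multiplier G f) \<le> ennreal ((real CARD('m))\<^sup>2) *
      (\<Sum>j\<in>(UNIV::'m set). \<Sum>k\<in>(UNIV::'m set). 4 * (ennreal ((real CARD('m))\<^sup>2 * C\<^sup>2 * 4) * L2_matrix_sq f))"
    by (intro order_trans[OF L2_matrix_sq_le[OF meas]] mult_left_mono sum_mono) simp_all
  also have "\<dots> = ennreal ((real CARD('m)) ^ 6 * C\<^sup>2 * 16) * L2_matrix_sq f"
  proof -
    have "(real CARD('m)) ^ 6 * C\<^sup>2 * 16 = (real CARD('m))\<^sup>2 *
        (real CARD('m) * (real CARD('m) * (4 * ((real CARD('m))\<^sup>2 * C\<^sup>2 * 4))))"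
      by (simp add: eval_nat_numeral)
    then have "ennreal ((real CARD('m)) ^ 6 * C\<^sup>2 * 16) = ennreal ((real CARD('m))\<^sup>2) * (ennreal (real CARD('m)) *
        (ennreal (real CARD('m)) * (ennreal 4 * ennreal ((real CARD('m))\<^sup>2 * C\<^sup>2 * 4))))"
      by (simp only: ennreal_mult[symmetric] zero_le_power2 of_nat_0_le_iff mult_nonneg_nonneg zero_le_numeral)
    then show ?thesis
      by (simp only: sum_constant ennreal_of_nat_eq_real_of_nat ennreal_numeral mult.assoc)
  qed
  finally show ?thesis .
qed

lemma fourier_multiplier_norm_le:
  assumes f: "L2_matrix f"
  shows "L2_matrix_norm (fourier_multiplier G f) \<le> sqrt ((real CARD('m)) ^ 6 * C\<^sup>2 * 16) * L2_matrix_norm f"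
proof -
  let ?K = "(real CARD('m)) ^ 6 * C\<^sup>2 * 16"
  \<comment> \<open>\<open>enn2real\<close> sends infinity to 0, so monotonicity requires a finite
    right-hand side.\<close>
  have "L2_matrix_sq f < \<infinity>"
    using f by (simp add: L2_matrix_iff_sq)
  then have "enn2real (L2_matrix_sq (fourier_multiplier G f)) \<le> enn2real (ennreal ?K * L2_matrix_sq f)"
    by (intro enn2real_mono fourier_multiplier_sq_le f) (simp add: ennreal_mult_less_top)
  also have "\<dots> = ?K * enn2real (L2_matrix_sq f)"
    by (simp add: enn2real_mult)
  finally have "sqrt (enn2real (L2_matrix_sq (fourier_multiplier G f))) \<le> sqrt (?K * enn2real (L2_matrix_sq f))"
    by (rule real_sqrt_le_mono)
  then show ?thesis
    using f fourier_multiplier_L2[OF f] by (simp only: L2_matrix_norm_eq L2_matrix_iff_sq real_sqrt_mult)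
qed

text \<open>\<open>h\<close> is given by its entries so that the vector sum and the entrywise
  complex multiple, written differently in \<open>bounded_L2_operator\<close>, are both
  instances.\<close>

lemma fourier_multiplier_lincomb:
  assumes f: "L2_matrix f" and g: "L2_matrix g"
    and h: "\<And>x j k. h x $ j $ k = f x $ j $ k + a * g x $ j $ k"
  shows "AE x in lborel. fourier_multiplier G h x $ j $ k =
    fourier_multiplier G f x $ j $ k + a * fourier_multiplier G g x $ j $ k"
proof -
  have hL2: "L2_matrix h"
    unfolding L2_matrix_iff h using f g
    by (auto simp: L2_matrix_iff intro!: L2_scalar_add L2_scalar_cmult)
  have "AE y in lborel. L2_extension fourier_int (\<lambda>x. h x $ j $ l) y =
      L2_extension fourier_int (\<lambda>x. f x $ j $ l) y + a * L2_extension fourier_int (\<lambda>x. g x $ j $ l) y" for l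
    using f g hL2 by (intro fourier.L2_extension_lincomb) (simp_all add: L2_matrix_iff h)
  then have "AE y in lborel. \<forall>l\<in>UNIV. L2_extension fourier_int (\<lambda>x. h x $ j $ l) y =
      L2_extension fourier_int (\<lambda>x. f x $ j $ l) y + a * L2_extension fourier_int (\<lambda>x. g x $ j $ l) y"
    by (intro AE_finite_allI) simp_all
  then have "AE y in lborel. multiplier_symbol G h j k y = multiplier_symbol G f j k y + a * multiplier_symbol G g j k y"
    by eventually_elim (simp add: multiplier_symbol_def sum_distrib_left distrib_right sum.distrib mult.assoc)
  then show ?thesis
    unfolding fourier_multiplier_nth
    by (intro inv_fourier.L2_extension_lincomb multiplier_symbol_L2 f g hL2)
qed

lemma bounded_L2_operator_fourier_multiplier: "bounded_L2_operator (fourier_multiplier G)"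
  unfolding bounded_L2_operator_def
proof (intro conjI allI impI exI)
  fix f g :: "real ^ 'n \<Rightarrow> complex ^ 'm ^ 'm" and a :: complex
  assume f: "L2_matrix f"
  show "L2_matrix (fourier_multiplier G f)"
    by (rule fourier_multiplier_L2[OF f])
  show "L2_matrix_norm (fourier_multiplier G f) \<le> sqrt ((real CARD('m)) ^ 6 * C\<^sup>2 * 16) * L2_matrix_norm f"
    by (rule fourier_multiplier_norm_le[OF f])
  show "AE x in lborel. fourier_multiplier G (\<lambda>x. \<chi> j k. a * f x $ j $ k) x =
      (\<chi> j k. a * fourier_multiplier G f x $ j $ k)"
  proof (rule AE_matrix_eqI)
    fix j k
    \<comment> \<open>Scalar multiplication as the linear combination
      \<open>f + (a - 1) * f\<close>.\<close>
    have "AE x in lborel. fourier_multiplier G (\<lambda>x. \<chi> j k. a * f x $ j $ k) x $ j $ k =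
        fourier_multiplier G f x $ j $ k + (a - 1) * fourier_multiplier G f x $ j $ k"
      by (rule fourier_multiplier_lincomb[OF f f]) (simp add: algebra_simps)
    then show "AE x in lborel. fourier_multiplier G (\<lambda>x. \<chi> j k. a * f x $ j $ k) x $ j $ k =
      (\<chi> j k. a * fourier_multiplier G f x $ j $ k) $ j $ k"
      by (simp add: algebra_simps)
  qed
  assume g: "L2_matrix g"
  show "AE x in lborel. fourier_multiplier G (\<lambda>x. f x + g x) x = fourier_multiplier G f x + fourier_multiplier G g x"
  proof (rule AE_matrix_eqI)
    fix j k
    show "AE x in lborel. fourier_multiplier G (\<lambda>x. f x + g x) x $ j $ k =
        (fourier_multiplier G f x + fourier_multiplier G g x) $ j $ k"
      using fourier_multiplier_lincomb[OF f g, of "\<lambda>x. f x + g x" 1] by simp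
  qed
qed

section \<open>A positive semidefinite input whose image is not self-adjoint\<close>

lemma positivity_preserving_imp_entry_eq_0:
  assumes pos: "positivity_preserving (fourier_multiplier G)" and ik: "i \<noteq> k"
  shows "G 0 $ i $ k = 0"
proof -
  let ?\<phi> = "\<lambda>x :: real ^ 'n. complex_of_real (gauss 1 x)"
  let ?Z = "\<lambda>x :: real ^ 'n. 0 :: complex"
  define f where "f x = (\<chi> j l. if j = i \<and> l = i then ?\<phi> x else 0)" for x
  \<comment> \<open>An equality of functions with the case distinction outside, since
    \<open>L2_extension\<close> takes the whole function as argument.\<close>
  have f_nth: "(\<lambda>x. f x $ j $ l) = (if j = i \<and> l = i then ?\<phi> else ?Z)" for j l
    by (auto simp: f_def)
  have gauss_le: "gauss 1 (x :: real ^ 'n) \<le> (2 * pi) powr (- real CARD('n) / 2)" for x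
    by (simp add: gauss_eq mult_left_le)
  have int: "integrable lborel ?\<phi>" "integrable lborel ?Z"
    by simp_all
  have \<phi>_L2: "L2_scalar ?\<phi>"
  proof -
    \<comment> \<open>A bounded integrable function is square integrable: its square is at most its
      supremum times itself.\<close>
    have "integrable lborel (\<lambda>x :: real ^ 'n. (2 * pi) powr (- real CARD('n) / 2) * gauss 1 x)"
      by simp
    then have "integrable lborel (\<lambda>x. (cmod (?\<phi> x))\<^sup>2)"
      by (rule Bochner_Integration.integrable_bound)
         (use mult_right_mono[OF gauss_le gauss_nonneg[of 1]] in \<open>auto simp: power2_eq_square\<close>)
    then show ?thesis
      by (simp add: L2_scalar_def)
  qed
  have f_L2: "L2_matrix f"
    unfolding L2_matrix_iff f_nth using \<phi>_L2 by simp
  have "pos_semidef (f x)" for x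
    unfolding pos_semidef_def
  proof (intro conjI allI)
    show "f x $ j $ l = cnj (f x $ l $ j)" for j l
      by (simp add: f_def)
    fix c :: "complex ^ 'm"
    have "cnj (c $ j) * f x $ j $ l * c $ l =
        (if l = i then if j = i then cnj (c $ i) * ?\<phi> x * c $ i else 0 else 0)" for j l
      by (simp add: f_def)
    then have "(\<Sum>j\<in>UNIV. \<Sum>l\<in>UNIV. cnj (c $ j) * f x $ j $ l * c $ l) = ?\<phi> x * (c $ i * cnj (c $ i))"
      by simp
    also have "\<dots> = complex_of_real (gauss 1 x * (cmod (c $ i))\<^sup>2)"
      by (simp only: of_real_mult complex_norm_square)
    finally show "(\<Sum>j\<in>UNIV. \<Sum>l\<in>UNIV. cnj (c $ j) * f x $ j $ l * c $ l) \<in> \<real>\<^sub>\<ge>\<^sub>0"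
      by simp
  qed
  then have "AE x in lborel. pos_semidef (fourier_multiplier G f x)"
    using pos f_L2 by (simp add: positivity_preserving_def)
  then have herm: "AE x in lborel. fourier_multiplier G f x $ i $ k = cnj (fourier_multiplier G f x $ k $ i)"
    by eventually_elim (unfold pos_semidef_def, blast)
  have zero_int: "fourier_int ?Z = ?Z" "inv_fourier_int ?Z = ?Z"
    by (simp_all add: fourier_int_def inv_fourier_int_def fun_eq_iff)
  have E\<phi>: "AE y in lborel. L2_extension fourier_int ?\<phi> y = ?\<phi> y"
    using fourier.L2_extension_eq[OF \<phi>_L2 int(1) \<phi>_L2] by (simp add: fourier_int_gauss)
  \<comment> \<open>Even for the zero function the choice operator may return any representative of
    zero.\<close>
  have E0: "AE y in lborel. L2_extension fourier_int ?Z y = 0"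
    using fourier.L2_extension_eq[OF L2_scalar_zero int(2) L2_scalar_zero] by (simp add: zero_int)
  have symbol: "AE y in lborel. multiplier_symbol G f j l y = (if j = i then ?\<phi> y * G y $ i $ l else 0)" for j l
    using E\<phi> E0
  proof eventually_elim
    case (elim y)
    then have "multiplier_symbol G f j l y = (\<Sum>p\<in>UNIV. if p = i then (if j = i then ?\<phi> y * G y $ i $ l else 0) else 0)"
      unfolding multiplier_symbol_def f_nth by (intro sum.cong refl) auto
    then show ?case
      by simp
  qed
  have "AE x in lborel. fourier_multiplier G f x $ k $ i = 0"
    unfolding fourier_multiplier_nth
    using inv_fourier.L2_extension_eq[OF multiplier_symbol_L2[OF f_L2] int(2) L2_scalar_zero, of k i]
      symbol[of k i] ik by (simp add: zero_int)
  moreover have "AE x in lborel. fourier_multiplier G f x $ i $ k = inv_fourier_int (\<lambda>y. ?\<phi> y * G y $ i $ k) x"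
    unfolding fourier_multiplier_nth
  proof (rule inv_fourier.L2_extension_eq[OF multiplier_symbol_L2[OF f_L2]])
    show "L2_scalar (\<lambda>y. ?\<phi> y * G y $ i $ k)"
      by (rule L2_scalar_mult_bounded(1)[OF \<phi>_L2 entry_measurable G_le])
    have "integrable lborel (\<lambda>y :: real ^ 'n. gauss 1 y * C)"
      by simp
    then show "integrable lborel (\<lambda>y. ?\<phi> y * G y $ i $ k)"
      by (rule Bochner_Integration.integrable_bound)
         (auto simp: norm_mult abs_mult intro!: mult_left_mono order_trans[OF G_le])
    show "AE y in lborel. multiplier_symbol G f i k y = ?\<phi> y * G y $ i $ k"
      using symbol[of i k] by simp
  qed
  ultimately have "AE x in lborel. inv_fourier_int (\<lambda>y. ?\<phi> y * G y $ i $ k) x = 0"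
    using herm by eventually_elim simp
  then show ?thesis
    by (rule inv_fourier_int_gauss_mult_eq_0[OF entry_continuous G_le])
qed

end

theorem theorem4p15:
  fixes F :: "real ^ 'n \<Rightarrow> complex ^ 'm ^ 'm"
  assumes "CARD('m) \<ge> 2"
    and "continuous_on UNIV F"
    and "cond_pos_semidef_fun F"
    and "\<exists>c :: real. \<forall>x j k. Re (F x $ j $ k) \<le> c"
  shows "\<forall>t :: real. t > 0 \<longrightarrow>
    bounded_L2_operator (fourier_multiplier (exp_Hadamard (\<lambda>x. t *\<^sub>R F x))) \<and>
    \<not> positivity_preserving (fourier_multiplier (exp_Hadamard (\<lambda>x. t *\<^sub>R F x)))"
proof (intro allI impI)
  fix t :: real
  assume t: "t > 0"
  obtain c where c: "\<And>x j k. Re (F x $ j $ k) \<le> c"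
    using assms(4) by blast
  \<comment> \<open>The modulus of an exponential is the exponential of the real part, so for
    \<open>t > 0\<close> the upper bound \<open>c\<close> on the real parts bounds the
    symbol.\<close>
  interpret bounded_symbol "exp_Hadamard (\<lambda>x. t *\<^sub>R F x)" "exp (t * c)"
  proof
    show "continuous_on UNIV (exp_Hadamard (\<lambda>x. t *\<^sub>R F x))"
      unfolding exp_Hadamard_def[abs_def] by (intro continuous_intros assms(2))
    show "cmod (exp_Hadamard (\<lambda>x. t *\<^sub>R F x) y $ j $ k) \<le> exp (t * c)" for y j k
      using t c by (simp add: exp_Hadamard_def)
  qed
  obtain i k :: 'm where ik: "i \<noteq> k"
    using assms(1) by (metis card_2_iff' ex_card finite subset_UNIV)
  have "exp_Hadamard (\<lambda>x. t *\<^sub>R F x) 0 $ i $ k \<noteq> 0"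
    by (simp add: exp_Hadamard_def)
  with ik show "bounded_L2_operator (fourier_multiplier (exp_Hadamard (\<lambda>x. t *\<^sub>R F x))) \<and>
      \<not> positivity_preserving (fourier_multiplier (exp_Hadamard (\<lambda>x. t *\<^sub>R F x)))"
    using bounded_L2_operator_fourier_multiplier positivity_preserving_imp_entry_eq_0 by blast
qed

end
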